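(* Fix $q\in[0,1]$ and rate functions $\{r(z,u)\}_{z\in\mathbb Z,u\ge0}$ with $0\le r(z,u)\le C$ for a constant $C$ and $u\mapsto r(z,u)$ piecewise continuous for each $z$. Consider the three-color ASEP (colors $1<2<+\infty$) with rates $r(z,u)$ and initial configuration $\eta_0(z)=1$ for $z<0$, $\eta_0(0)=2$, $\eta_0(z)=+\infty$ for $z>0$, and let $\mathfrak f_2(u)$ be the position at time $u$ of its unique particle of color 2. Fix $\tau\ge 0$ and $x\in\mathbb R$, and consider the two-color ASEP (colors $1<+\infty$) with initial configuration $\hat\eta_0(z)=1$ for $z\le x$, $\hat\eta_0(z)=+\infty$ for $z>x$, and time-reversed rates $\hat r(z,u):=r(z,\tau-u)$, $0\le u\le\tau$; let $\mathfrak p_1^x(\tau)$ be the probability that in this process site $0$ is occupied by a particle of color $1$ at time $\tau$. Then $$\mathrm{Prob}(\mathfrak f_2(\tau)\le x)=\mathfrak p_1^x(\tau).$$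
   Context: A configuration is a map $\eta:\mathbb Z\to\mathbb Z\cup\{+\infty\}$ giving the color of the particle at each site (color $+\infty$ represents a hole). For $x'\in[0,1]$ the random asymmetric swap $W_{(z,z+1),x'}$ exchanges the values $\eta(z),\eta(z+1)$ with probability $x'$ if $\eta(z)<\eta(z+1)$, with probability $qx'$ if $\eta(z)>\eta(z+1)$, and otherwise leaves $\eta$ unchanged. The (inhomogeneous) colored ASEP with rates $r(z,u)$: independent Poisson processes $\mathcal P(z)$, $z\in\mathbb Z$, with intensity $r(z,u)$ at time $u$; at each point of $\mathcal P(z)$ the swap $W_{(z,z+1),1}$ is applied to the current configuration. Thus a particle of lower color exchanges with a higher color on its right at rate $r(z,u)$ and with a higher color on its left at rate $q\,r(z,u)$. *)

theory Defs
  imports "HOL-Probability.Probability"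
begin

text \<open>Colors are elements of Z together with +infinity (a hole); we use ereal,
  only ever using integer values and PInfty.\<close>

type_synonym config = "int \<Rightarrow> ereal"

definition piecewise_continuous :: "(real \<Rightarrow> real) \<Rightarrow> bool" where
  "piecewise_continuous f \<longleftrightarrow>
     (\<forall>T\<ge>0. \<exists>S. finite S \<and>
        (\<forall>u\<in>{0..T} - S. continuous (at u within {0..}) f) \<and>
        (\<forall>s\<in>S. (\<exists>l. (f \<longlongrightarrow> l) (at_left s)) \<and> (\<exists>l. (f \<longlongrightarrow> l) (at_right s))))"

text \<open>Random asymmetric swap W_{(z,z+1),1}, realised with an auxiliary uniform
  variable U in [0,1]: if eta z < eta (z+1) the values are exchanged (probability 1);
  if eta z > eta (z+1) they are exchanged iff U < q (probability q); otherwise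
  nothing happens.\<close>
definition swap_at :: "real \<Rightarrow> int \<Rightarrow> real \<Rightarrow> config \<Rightarrow> config" where
  "swap_at q z U \<eta> =
     (if \<eta> z < \<eta> (z+1) \<or> (\<eta> z > \<eta> (z+1) \<and> U < q)
      then \<eta>(z := \<eta> (z+1), z+1 := \<eta> z) else \<eta>)"

definition clock_mass :: "(int \<Rightarrow> real \<Rightarrow> real) \<Rightarrow> real \<Rightarrow> int \<Rightarrow> real" where
  "clock_mass r \<tau> z = (LBINT u=0..\<tau>. r z u)"

definition count_dist :: "(int \<Rightarrow> real \<Rightarrow> real) \<Rightarrow> real \<Rightarrow> int \<Rightarrow> nat measure" where
  "count_dist r \<tau> z =
     (if 0 < clock_mass r \<tau> z then measure_pmf (poisson_pmf (clock_mass r \<tau> z))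
      else measure_pmf (return_pmf 0))"

definition time_dist :: "(int \<Rightarrow> real \<Rightarrow> real) \<Rightarrow> real \<Rightarrow> int \<Rightarrow> real measure" where
  "time_dist r \<tau> z =
     (if 0 < clock_mass r \<tau> z
      then density lborel (\<lambda>u. ennreal (indicator {0..\<tau>} u * r z u / clock_mass r \<tau> z))
      else return borel 0)"

text \<open>A Poisson process on [0,tau] with intensity r(z,.), marked with independent
  uniform [0,1] coins: a count N together with an i.i.d. sequence of (time, coin)
  pairs, of which the first N are the rings.\<close>
definition site_clock :: "(int \<Rightarrow> real \<Rightarrow> real) \<Rightarrow> real \<Rightarrow> int \<Rightarrow> (nat \<times> (nat \<Rightarrow> real \<times> real)) measure" where
  "site_clock r \<tau> z =
     count_dist r \<tau> z \<Otimes>\<^sub>M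
     (\<Pi>\<^sub>M i\<in>(UNIV::nat set). time_dist r \<tau> z \<Otimes>\<^sub>M uniform_measure lborel {0..1::real})"

definition clocks :: "(int \<Rightarrow> real \<Rightarrow> real) \<Rightarrow> real \<Rightarrow> (int \<Rightarrow> nat \<times> (nat \<Rightarrow> real \<times> real)) measure" where
  "clocks r \<tau> = (\<Pi>\<^sub>M z\<in>(UNIV::int set). site_clock r \<tau> z)"

definition window_events ::
  "real \<Rightarrow> (int \<Rightarrow> nat \<times> (nat \<Rightarrow> real \<times> real)) \<Rightarrow> nat \<Rightarrow> (real \<times> int \<times> real) list" where
  "window_events \<tau> \<omega> N =
     sort_key fst
       (filter (\<lambda>e. fst e \<le> \<tau>)
         (concat (map (\<lambda>z. map (\<lambda>i. (fst (snd (\<omega> z) i), z, snd (snd (\<omega> z) i)))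
                                 [0..<fst (\<omega> z)])
                      [- int N..int N])))"

definition window_config ::
  "real \<Rightarrow> real \<Rightarrow> config \<Rightarrow> (int \<Rightarrow> nat \<times> (nat \<Rightarrow> real \<times> real)) \<Rightarrow> nat \<Rightarrow> config" where
  "window_config q \<tau> \<eta>0 \<omega> N =
     fold (\<lambda>(t, z, U) \<eta>. swap_at q z U \<eta>) (window_events \<tau> \<omega> N) \<eta>0"

text \<open>Configuration of the infinite-volume ASEP at time tau (Harris construction):
  the value at each site is the eventual value of the finite-volume approximations
  (this stabilisation holds almost surely for bounded rates).\<close>
definition asep_config ::
  "real \<Rightarrow> real \<Rightarrow> config \<Rightarrow> (int \<Rightarrow> nat \<times> (nat \<Rightarrow> real \<times> real)) \<Rightarrow> config" where
  "asep_config q \<tau> \<eta>0 \<omega> y =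
     (if \<exists>c. eventually (\<lambda>N. window_config q \<tau> \<eta>0 \<omega> N y = c) sequentially
      then (THE c. eventually (\<lambda>N. window_config q \<tau> \<eta>0 \<omega> N y = c) sequentially)
      else PInfty)"

definition eta0_three :: config where
  "eta0_three z = (if z < 0 then 1 else if z = 0 then 2 else PInfty)"

definition eta0_step :: "real \<Rightarrow> config" where
  "eta0_step x z = (if real_of_int z \<le> x then 1 else PInfty)"

definition f2 :: "real \<Rightarrow> real \<Rightarrow> (int \<Rightarrow> nat \<times> (nat \<Rightarrow> real \<times> real)) \<Rightarrow> int" where
  "f2 q \<tau> \<omega> = (THE y. asep_config q \<tau> eta0_three \<omega> y = 2)"

end

theory Submission
  imports Defs "HOL-Combinatorics.Transposition"
begin

text \<open>Both processes are monotone images of the ASEP started from the packed configuration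
  \<open>id\<close>, in which every site carries its own color: merging colors commutes with every swap. If
  \<open>w\<close> is the resulting bijection, the tagged particle sits at \<open>inv w 0\<close>, and the two-color process
  has a particle at \<open>0\<close> iff \<open>w 0 \<le> x\<close>. So it suffices that \<open>inv w\<close> has the law of the bijection
  produced by the reversed sequence of rings. For a fixed sequence of edges and independent coins
  this is the anti-involution of the Hecke algebra. In a finite window the coins are independent of
  the edge sequence, and reflecting all ring times in \<open>[0, \<tau>]\<close> reverses that sequence almost
  surely. Finally, almost surely some edge on each side of the origin never rings, so the finite
  windows stabilise.\<close>

section \<open>Color-position symmetry\<close>

text \<open>The symmetry is one of laws and fails pathwise. If one edge rings twice, starting from
  \<open>id\<close>, the first ring swaps for certain and the coin of the second decides whether the
  swap is undone; in reversed order the other coin decides. Reflecting the clocks together with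
  their coins therefore does not invert the bijection. This fixes the order of the argument: first
  average over the coins with the ordered list of ring labels frozen, which leaves a deterministic
  function of the word of edges, then reverse the word, and only then reflect the times. On the
  whole line there is in general no first ring and so no word to reverse; hence the identity is
  proved window by window, and the two probabilities are limits of one sequence. The encoding of a
  clock as a count with i.i.d. marks suits this plan: reflecting the times and refreshing a coin are
  coordinatewise maps of a product measure.\<close>

abbreviation adj_transp :: "int \<Rightarrow> int \<Rightarrow> int" where
  "adj_transp z \<equiv> Transposition.transpose z (z + 1)"

text \<open>\<open>swap_op q z\<close> is the transition operator of the random swap acting on the positions of a
  configuration; \<open>color_op q z\<close>, its conjugate under inversion, acts on the colors.\<close>

definition swap_op :: "real \<Rightarrow> int \<Rightarrow> ((int \<Rightarrow> int) \<Rightarrow> real) \<Rightarrow> (int \<Rightarrow> int) \<Rightarrow> real" where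
  "swap_op q z F w =
     (if w z < w (z + 1) then F (w \<circ> adj_transp z)
      else q * F (w \<circ> adj_transp z) + (1 - q) * F w)"

definition color_op :: "real \<Rightarrow> int \<Rightarrow> ((int \<Rightarrow> int) \<Rightarrow> real) \<Rightarrow> (int \<Rightarrow> int) \<Rightarrow> real" where
  "color_op q z F w = swap_op q z (\<lambda>v. F (inv v)) (inv w)"

text \<open>Conjugation by inversion turns the exchange of the contents of two sites into an
  exchange of the colors \<open>z\<close> and \<open>z + 1\<close>, decided by which of them stands
  further left.\<close>

lemma color_op_bij:
  assumes "bij w"
  shows "color_op q z F w =
    (if inv w z < inv w (z + 1) then F (adj_transp z \<circ> w)
     else q * F (adj_transp z \<circ> w) + (1 - q) * F w)"
proof -
  have "inv (inv w \<circ> adj_transp z) = adj_transp z \<circ> w"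
    using assms by (simp add: o_inv_distrib bij_imp_bij_inv inv_inv_eq)
  then show ?thesis
    using assms by (simp add: color_op_def swap_op_def inv_inv_eq)
qed

text \<open>The two actions meet only if the sites \<open>y\<close>, \<open>y + 1\<close> hold
  exactly the colors \<open>z\<close>, \<open>z + 1\<close>. Then both perform the same exchange
  under the same condition. Otherwise neither affects the comparison made by the other, and the
  order of averaging is immaterial.\<close>

lemma swap_op_color_op_commute:
  assumes w: "bij w"
  shows "swap_op q y (color_op q z F) w = color_op q z (swap_op q y F) w"
proof -
  let ?s = "adj_transp y" and ?t = "adj_transp z"
  have ws: "bij (w \<circ> ?s)"
    using w by (simp add: bij_comp)
  have inv_ws: "inv (w \<circ> ?s) = ?s \<circ> inv w"
    using w by (simp add: o_inv_distrib)
  have assoc: "?t \<circ> (w \<circ> ?s) = ?t \<circ> w \<circ> ?s"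
    by (simp add: comp_assoc)
  define a b c d where "a = w y" and "b = w (y + 1)" and "c = inv w z" and "d = inv w (z + 1)"
  have ab: "a \<noteq> b"
    using w unfolding a_def b_def by (metis bij_is_inj inj_eq less_add_one less_irrefl)
  have iff: "inv w i = j \<longleftrightarrow> w j = i" for i j
    using w by (metis bij_inv_eq_iff)
  show ?thesis
  proof (cases "{a, b} = {z, z + 1}")
    case True
    then have cases: "a = z \<and> b = z + 1 \<and> c = y \<and> d = y + 1 \<or> a = z + 1 \<and> b = z \<and> c = y + 1 \<and> d = y"
      by (auto simp: doubleton_eq_iff iff a_def b_def c_def d_def)
    have eq: "?t \<circ> w = w \<circ> ?s"
    proof
      fix i
      consider "i = y" | "i = y + 1" | "w i \<noteq> a" "w i \<noteq> b" "i \<noteq> y" "i \<noteq> y + 1"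
        using w unfolding a_def b_def by (metis bij_is_inj inj_eq)
      then show "(?t \<circ> w) i = (w \<circ> ?s) i"
        by cases (use cases in \<open>auto simp: a_def b_def\<close>)
    qed
    have ord: "inv w z < inv w (z + 1) \<longleftrightarrow> w y < w (y + 1)"
      using cases unfolding a_def b_def c_def d_def by auto
    have cond: "inv (w \<circ> ?s) z < inv (w \<circ> ?s) (z + 1) \<longleftrightarrow> (w \<circ> ?s) y < (w \<circ> ?s) (y + 1)"
      using cases unfolding inv_ws a_def b_def c_def d_def by auto
    have swap_swap: "w \<circ> ?s \<circ> ?s = w"
      by (simp add: comp_assoc)
    have "?t \<circ> (w \<circ> ?s) = w"
      by (metis assoc eq swap_swap)
    then show ?thesis
      using eq ord cond swap_swap
      by (simp add: swap_op_def color_op_bij[OF w] color_op_bij[OF ws])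
  next
    case False
    \<comment> \<open>Exchanging the adjacent colors \<open>z\<close>, \<open>z + 1\<close> reverses
      the order of no other pair of colors; \<open>2\<close> is the same remark for
      positions.\<close>
    have 1: "(?t \<circ> w) y < (?t \<circ> w) (y + 1) \<longleftrightarrow> w y < w (y + 1)"
      using False ab unfolding o_apply a_def[symmetric] b_def[symmetric]
      by (auto simp: Transposition.transpose_def)
    have cd: "{c, d} \<noteq> {y, y + 1}"
      using False iff unfolding a_def b_def c_def d_def
      by (auto simp: doubleton_eq_iff)
    have "c \<noteq> d"
      using iff unfolding c_def d_def by (metis less_add_one less_irrefl)
    then have 2: "inv (w \<circ> ?s) z < inv (w \<circ> ?s) (z + 1) \<longleftrightarrow> inv w z < inv w (z + 1)"
      using cd unfolding inv_ws o_apply c_def[symmetric] d_def[symmetric]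
      by (auto simp: Transposition.transpose_def)
    show ?thesis
      using 1 2 unfolding swap_op_def color_op_bij[OF w] color_op_bij[OF ws] comp_assoc
      by (simp add: right_diff_distrib left_diff_distrib distrib_left)
  qed
qed

lemma swap_op_cong:
  assumes "bij w" "\<And>v. bij v \<Longrightarrow> F v = G v"
  shows "swap_op q z F w = swap_op q z G w"
  using assms by (simp add: swap_op_def bij_comp)

text \<open>Transition operators act on functionals, so \<open>foldr (swap_op q) zs F w\<close> is
  the mean of \<open>F\<close> after the swaps of \<open>zs\<close> in list order, started from
  \<open>w\<close>. On bijections \<open>inv\<close> is a genuine inverse.\<close>

lemma foldr_swap_op_cong:
  assumes "bij w" "\<And>v. bij v \<Longrightarrow> F v = G v"
  shows "foldr (swap_op q) zs F w = foldr (swap_op q) zs G w"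
  using assms(1)
proof (induction zs arbitrary: w)
  case (Cons z zs)
  then show ?case
    by (auto intro!: swap_op_cong)
qed (simp add: assms)

lemma foldr_swap_op_color_op:
  assumes "bij w"
  shows "color_op q z (foldr (swap_op q) zs F) w = foldr (swap_op q) zs (color_op q z F) w"
  using assms
proof (induction zs arbitrary: w)
  case (Cons y zs)
  have "color_op q z (foldr (swap_op q) (y # zs) F) w
      = swap_op q y (color_op q z (foldr (swap_op q) zs F)) w"
    by (simp add: swap_op_color_op_commute Cons.prems)
  also have "\<dots> = swap_op q y (foldr (swap_op q) zs (color_op q z F)) w"
    by (intro swap_op_cong Cons)
  finally show ?case by simp
qed simp

text \<open>Acting on positions and acting on colors commute and agree at the identity, so the
  letters can be moved one by one from the front of the word to its back.\<close>

lemma foldr_swap_op_rev: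
  "foldr (swap_op q) zs F id = foldr (swap_op q) (rev zs) (\<lambda>w. F (inv w)) id"
proof (induction zs arbitrary: F)
  case (Cons z zs)
  have "foldr (swap_op q) (z # zs) F id = color_op q z (foldr (swap_op q) zs F) id"
    by (simp add: color_op_bij swap_op_def)
  also have "\<dots> = foldr (swap_op q) zs (color_op q z F) id"
    by (simp add: foldr_swap_op_color_op)
  also have "\<dots> = foldr (swap_op q) (rev zs) (\<lambda>w. color_op q z F (inv w)) id"
    by (rule Cons)
  \<comment> \<open>Reading the functional at the inverse cancels the conjugation inside
    \<open>color_op\<close>: the moved letter is an ordinary swap again, now performed last.\<close>
  also have "\<dots> = foldr (swap_op q) (rev zs) (swap_op q z (\<lambda>w. F (inv w))) id"
    by (intro foldr_swap_op_cong) (simp_all add: color_op_def inv_inv_eq)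
  finally show ?case by (simp add: id_def)
qed simp

section \<open>Coupling and stabilisation\<close>

text \<open>Polymorphic in the colors, so that the packed configuration with integer colors and the
  given \<open>ereal\<close> configurations run under the same rule.\<close>

definition swap_step :: "real \<Rightarrow> int \<Rightarrow> real \<Rightarrow> (int \<Rightarrow> 'a::linorder) \<Rightarrow> int \<Rightarrow> 'a" where
  "swap_step q z U w =
     (if w z < w (z + 1) \<or> w z > w (z + 1) \<and> U < q then w \<circ> adj_transp z else w)"

lemma comp_adj_transp: "w \<circ> adj_transp z = w(z := w (z + 1), z + 1 := w z)"
  by (auto simp: fun_eq_iff Transposition.transpose_def)

lemma swap_at_eq_swap_step: "swap_at q z U = swap_step q z U"
  by (simp add: fun_eq_iff swap_at_def swap_step_def comp_adj_transp)

text \<open>If \<phi> separates the two colors, it keeps their strict order and the same decision is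
  taken. If it merges them, the image is the same whether or not they are exchanged.\<close>

lemma swap_step_comp:
  fixes w :: "int \<Rightarrow> 'a::linorder" and \<phi> :: "'a \<Rightarrow> 'b::linorder"
  assumes "mono \<phi>"
  shows "swap_step q z U (\<phi> \<circ> w) = \<phi> \<circ> swap_step q z U w"
proof (cases "\<phi> (w z) = \<phi> (w (z + 1))")
  case True
  then have "\<phi> \<circ> (w \<circ> adj_transp z) = \<phi> \<circ> w"
    by (auto simp: fun_eq_iff Transposition.transpose_def)
  with True show ?thesis
    by (simp add: swap_step_def)
next
  case False
  then have "\<phi> (w z) < \<phi> (w (z + 1)) \<longleftrightarrow> w z < w (z + 1)"
    and "\<phi> (w (z + 1)) < \<phi> (w z) \<longleftrightarrow> w (z + 1) < w z"
    using assms by (metis leD leI monoD order_less_le)+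
  then show ?thesis
    by (simp add: swap_step_def comp_assoc)
qed

section \<open>Ring labels and the packed process in a finite window\<close>

type_synonym rings = "int \<Rightarrow> nat \<times> (nat \<Rightarrow> real \<times> real)"

definition ring_time :: "rings \<Rightarrow> int \<times> nat \<Rightarrow> real" where
  "ring_time \<omega> e = fst (snd (\<omega> (fst e)) (snd e))"

definition ring_coin :: "rings \<Rightarrow> int \<times> nat \<Rightarrow> real" where
  "ring_coin \<omega> e = snd (snd (\<omega> (fst e)) (snd e))"

definition ring_labels :: "rings \<Rightarrow> int list \<Rightarrow> (int \<times> nat) list" where
  "ring_labels \<omega> zs = concat (map (\<lambda>z. map (Pair z) [0..<fst (\<omega> z)]) zs)"

text \<open>Labels are sorted instead of events because the resulting list depends on counts and
  times only: fixing it leaves every coin free.\<close>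

definition ordered_labels :: "real \<Rightarrow> rings \<Rightarrow> nat \<Rightarrow> (int \<times> nat) list" where
  "ordered_labels \<tau> \<omega> N = sort_key (ring_time \<omega>)
     (filter (\<lambda>e. ring_time \<omega> e \<le> \<tau>) (ring_labels \<omega> [- int N..int N]))"

definition run :: "real \<Rightarrow> rings \<Rightarrow> (int \<times> nat) list \<Rightarrow> (int \<Rightarrow> 'a::linorder) \<Rightarrow> int \<Rightarrow> 'a" where
  "run q \<omega> L = fold (\<lambda>e. swap_step q (fst e) (ring_coin \<omega> e)) L"

definition perm_config :: "real \<Rightarrow> real \<Rightarrow> rings \<Rightarrow> nat \<Rightarrow> int \<Rightarrow> int" where
  "perm_config q \<tau> \<omega> N = run q \<omega> (ordered_labels \<tau> \<omega> N) id"

lemma run_Nil [simp]: "run q \<omega> [] w = w"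
  and run_Cons [simp]: "run q \<omega> (e # L) w = run q \<omega> L (swap_step q (fst e) (ring_coin \<omega> e) w)"
  by (simp_all add: run_def)

lemma insort_key_map: "insort_key f (g x) (map g xs) = map g (insort_key (\<lambda>x. f (g x)) x xs)"
  by (induction xs) auto

lemma sort_key_map: "sort_key f (map g xs) = map g (sort_key (\<lambda>x. f (g x)) xs)"
  by (induction xs) (simp_all add: insort_key_map)

lemma window_events_eq:
  "window_events \<tau> \<omega> N =
     map (\<lambda>e. (ring_time \<omega> e, fst e, ring_coin \<omega> e)) (ordered_labels \<tau> \<omega> N)"
proof -
  have "concat (map (\<lambda>z. map (\<lambda>i. (fst (snd (\<omega> z) i), z, snd (snd (\<omega> z) i))) [0..<fst (\<omega> z)]) zs)
      = map (\<lambda>e. (ring_time \<omega> e, fst e, ring_coin \<omega> e)) (ring_labels \<omega> zs)" for zs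
    by (induction zs) (auto simp: ring_labels_def ring_time_def ring_coin_def)
  then show ?thesis
    by (simp add: window_events_def ordered_labels_def filter_map sort_key_map o_def)
qed

lemma run_comp:
  assumes "mono \<phi>"
  shows "run q \<omega> L (\<phi> \<circ> w) = \<phi> \<circ> run q \<omega> L w"
  by (induction L arbitrary: w) (simp_all add: swap_step_comp[OF assms])

lemma window_config_eq:
  assumes "mono \<eta>"
  shows "window_config q \<tau> \<eta> \<omega> N = \<eta> \<circ> perm_config q \<tau> \<omega> N"
proof -
  have "window_config q \<tau> \<eta> \<omega> N = run q \<omega> (ordered_labels \<tau> \<omega> N) (\<eta> \<circ> id)"
    by (simp add: window_config_def window_events_eq run_def fold_map o_def swap_at_eq_swap_step
        case_prod_unfold)
  then show ?thesis
    by (simp only: run_comp[OF assms] perm_config_def)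
qed

lemma bij_swap_step: "bij w \<Longrightarrow> bij (swap_step q z U w)"
  by (simp add: swap_step_def bij_comp)

lemma bij_run: "bij w \<Longrightarrow> bij (run q \<omega> L w)"
  by (induction L arbitrary: w) (simp_all add: bij_swap_step)

lemma bij_perm_config: "bij (perm_config q \<tau> \<omega> N)"
  by (simp add: perm_config_def bij_run)

section \<open>Initial data and values of the limiting configuration\<close>

lemma mono_eta0_three: "mono eta0_three"
  by (auto simp: mono_def eta0_three_def)

lemma mono_eta0_step: "mono (eta0_step x)"
  by (auto simp: mono_def eta0_step_def)

lemma eta0_three_eq_two: "eta0_three y = 2 \<longleftrightarrow> y = 0"
  by (auto simp: eta0_three_def)

lemma eta0_step_eq_one: "eta0_step x y = 1 \<longleftrightarrow> real_of_int y \<le> x"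
  by (auto simp: eta0_step_def)

text \<open>\<open>PInfty\<close> is also the default value where the windows do not stabilise, so
  any other value certifies stabilisation.\<close>

lemma asep_config_eq_iff:
  assumes "c \<noteq> PInfty"
  shows "asep_config q \<tau> \<eta> \<omega> y = c \<longleftrightarrow>
    (\<forall>\<^sub>F N in sequentially. window_config q \<tau> \<eta> \<omega> N y = c)"
proof -
  have uniq: "c = c'"
    if "\<forall>\<^sub>F N in sequentially. window_config q \<tau> \<eta> \<omega> N y = c"
      "\<forall>\<^sub>F N in sequentially. window_config q \<tau> \<eta> \<omega> N y = c'" for c c'
  proof -
    have "\<forall>\<^sub>F N in sequentially. c = c'"
      using that by eventually_elim simp
    then show ?thesis by simp
  qed
  then have "(THE c. \<forall>\<^sub>F N in sequentially. window_config q \<tau> \<eta> \<omega> N y = c) = c'"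
    if "\<forall>\<^sub>F N in sequentially. window_config q \<tau> \<eta> \<omega> N y = c'" for c'
    using that by (intro the_equality) blast+
  then show ?thesis
    using assms by (auto simp: asep_config_def)
qed

lemma asep_three_eq_two_iff:
  "asep_config q \<tau> eta0_three \<omega> y = 2 \<longleftrightarrow>
    (\<forall>\<^sub>F N in sequentially. perm_config q \<tau> \<omega> N y = 0)"
proof -
  have "(2 :: ereal) \<noteq> PInfty" by simp
  then show ?thesis
    by (simp only: asep_config_eq_iff[of 2] window_config_eq[OF mono_eta0_three] o_apply eta0_three_eq_two
        not_False_eq_True simp_thms)
qed

lemma asep_step_eq_one_iff:
  "asep_config q \<tau> (eta0_step x) \<omega> y = 1 \<longleftrightarrow>
    (\<forall>\<^sub>F N in sequentially. real_of_int (perm_config q \<tau> \<omega> N y) \<le> x)"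
  by (simp add: asep_config_eq_iff window_config_eq mono_eta0_step eta0_step_eq_one)

text \<open>Two limiting sites of the tagged particle would both carry color 0 in one sufficiently
  large window, where the configuration is injective.\<close>

lemma f2_eq:
  assumes "asep_config q \<tau> eta0_three \<omega> y = 2"
  shows "f2 q \<tau> \<omega> = y"
  unfolding f2_def
proof (rule the_equality)
  fix y' assume "asep_config q \<tau> eta0_three \<omega> y' = 2"
  then have "\<forall>\<^sub>F N in sequentially. y' = y"
    using assms unfolding asep_three_eq_two_iff
    by eventually_elim (metis bij_perm_config bij_is_inj injD)
  then show "y' = y" by simp
qed fact

text \<open>If the tagged particle has no limiting position, the definite description is the junk
  value \<open>THE y. False\<close>, which does not depend on the realisation.\<close>

lemma f2_le_iff:
  "real_of_int (f2 q \<tau> \<omega>) \<le> x \<longleftrightarrow>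
    (\<exists>y. real_of_int y \<le> x \<and> asep_config q \<tau> eta0_three \<omega> y = 2) \<or>
    (\<nexists>y. asep_config q \<tau> eta0_three \<omega> y = 2) \<and> real_of_int (THE y. False) \<le> x"
proof (cases "\<exists>y. asep_config q \<tau> eta0_three \<omega> y = 2")
  case True
  then show ?thesis using f2_eq by metis
next
  case False
  then have "f2 q \<tau> \<omega> = (THE y. False)" by (simp add: f2_def)
  with False show ?thesis by simp
qed

section \<open>Blocks between silent edges\<close>

lemma adj_transp_image_block:
  assumes "z \<noteq> a" "z \<noteq> b"
  shows "adj_transp z ` {a<..b} = {a<..b}"
proof -
  have "adj_transp z ` {a<..b} \<subseteq> {a<..b}"
    using assms by (auto simp: Transposition.transpose_def)
  moreover from this have "adj_transp z ` adj_transp z ` {a<..b} \<subseteq> adj_transp z ` {a<..b}"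
    by (rule image_mono)
  ultimately show ?thesis
    by (simp add: image_comp)
qed

text \<open>Edge \<open>z\<close> joins the sites \<open>z\<close> and \<open>z + 1\<close>, so
  silent edges \<open>a\<close> and \<open>b\<close> cut off exactly the sites of
  \<open>{a<..b}\<close>.\<close>

lemma run_image_block:
  assumes "\<And>e. e \<in> set L \<Longrightarrow> fst e \<noteq> a \<and> fst e \<noteq> b"
  shows "run q \<omega> L w ` {a<..b} = w ` {a<..b}"
  using assms
proof (induction L arbitrary: w)
  case (Cons e L)
  have "swap_step q (fst e) (ring_coin \<omega> e) w ` {a<..b} = w ` {a<..b}"
    using Cons.prems[of e] by (simp add: swap_step_def image_comp[symmetric] adj_transp_image_block del: o_apply)
  with Cons show ?case by simp
qed simp

text \<open>A ring strictly between \<open>a\<close> and \<open>b\<close> reads and writes only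
  sites of the block, any other ring touches none of them. The start configurations need to agree on
  the block only, because the discarded rings alter \<open>w\<close> outside it during the
  induction.\<close>

lemma run_filter_block:
  assumes "\<And>e. e \<in> set L \<Longrightarrow> fst e \<noteq> a \<and> fst e \<noteq> b"
    and "\<And>y. y \<in> {a<..b} \<Longrightarrow> w y = w' y"
    and "y \<in> {a<..b}"
  shows "run q \<omega> L w y = run q \<omega> (filter (\<lambda>e. a < fst e \<and> fst e < b) L) w' y"
  using assms
proof (induction L arbitrary: w w')
  case (Cons e L)
  let ?s = "swap_step q (fst e) (ring_coin \<omega> e)"
  have e: "fst e \<noteq> a" "fst e \<noteq> b" using Cons.prems(1) by auto
  show ?case
  proof (cases "a < fst e \<and> fst e < b")
    case True
    have "?s w y = ?s w' y" if "y \<in> {a<..b}" for y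
      using True that Cons.prems(2)
      by (auto simp: swap_step_def Transposition.transpose_def)
    with True show ?thesis
      using Cons.IH[of "?s w" "?s w'"] Cons.prems by simp
  next
    case False
    have "?s w y = w' y" if "y \<in> {a<..b}" for y
      using False e that Cons.prems(2)
      by (auto simp: swap_step_def Transposition.transpose_def)
    with False show ?thesis
      using Cons.IH[of "?s w" w'] Cons.prems by auto
  qed
qed simp

lemma set_ring_labels: "set (ring_labels \<omega> zs) = {(z, i). z \<in> set zs \<and> i < fst (\<omega> z)}"
  by (auto simp: ring_labels_def)

lemma set_ordered_labels:
  "set (ordered_labels \<tau> \<omega> N) =
    {e. - int N \<le> fst e \<and> fst e \<le> int N \<and> snd e < fst (\<omega> (fst e)) \<and> ring_time \<omega> e \<le> \<tau>}"
  by (auto simp: ordered_labels_def set_ring_labels)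

lemma distinct_ring_labels: "distinct zs \<Longrightarrow> distinct (ring_labels \<omega> zs)"
  by (induction zs) (auto simp: ring_labels_def distinct_map inj_on_def)

text \<open>Each coin is used at most once in a run, which makes the successive decisions
  independent.\<close>

lemma distinct_ordered_labels: "distinct (ordered_labels \<tau> \<omega> N)"
  by (simp add: ordered_labels_def distinct_ring_labels)

text \<open>The filter removes the labels of the two new boundary edges, and filtering commutes with
  the stable sort.\<close>

lemma filter_ordered_labels_Suc:
  assumes "- int N \<le> a" "b \<le> int N"
  shows "filter (\<lambda>e. a < fst e \<and> fst e < b) (ordered_labels \<tau> \<omega> (Suc N))
       = filter (\<lambda>e. a < fst e \<and> fst e < b) (ordered_labels \<tau> \<omega> N)"
proof -
  let ?P = "\<lambda>e :: int \<times> nat. a < fst e \<and> fst e < b"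
  have "[- int (Suc N)..int (Suc N)] = (- int (Suc N)) # [- int N..int N] @ [int (Suc N)]"
    using upto_rec1[of "- int (Suc N)" "int (Suc N)"] upto_rec2[of "- int N" "int (Suc N)"] by simp
  moreover have "ring_labels \<omega> (z # zs @ [z']) =
      ring_labels \<omega> [z] @ ring_labels \<omega> zs @ ring_labels \<omega> [z']" for z zs z'
    by (simp add: ring_labels_def)
  moreover have "filter ?P (ring_labels \<omega> [- int (Suc N)]) = []"
    "filter ?P (ring_labels \<omega> [int (Suc N)]) = []"
    using assms by (auto simp: ring_labels_def filter_empty_conv)
  ultimately have *: "filter ?P (ring_labels \<omega> [- int (Suc N)..int (Suc N)])
      = filter ?P (ring_labels \<omega> [- int N..int N])"
    by (simp only: filter_append append_Nil append_Nil2)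
  have "filter ?P (filter Q xs) = filter Q (filter ?P xs)" for Q and xs :: "(int \<times> nat) list"
    by (simp add: conj_commute)
  then show ?thesis
    by (simp only: ordered_labels_def filter_sort *)
qed

text \<open>An edge that never rings separates the system, so a block between two such edges does not
  feel the size of the window.\<close>

lemma perm_config_block:
  assumes quiet: "fst (\<omega> a) = 0" "fst (\<omega> b) = 0"
    and N: "- int N0 \<le> a" "b \<le> int N0" "N0 \<le> N"
  shows "perm_config q \<tau> \<omega> N ` {a<..b} = {a<..b}"
    and "y \<in> {a<..b} \<Longrightarrow> perm_config q \<tau> \<omega> N y = perm_config q \<tau> \<omega> N0 y"
proof -
  have ab: "fst e \<noteq> a \<and> fst e \<noteq> b" if "e \<in> set (ordered_labels \<tau> \<omega> N)" for e N
    using that quiet by (auto simp: set_ordered_labels)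
  show "perm_config q \<tau> \<omega> N ` {a<..b} = {a<..b}"
    unfolding perm_config_def by (subst run_image_block[OF ab]) simp_all
  show "perm_config q \<tau> \<omega> N y = perm_config q \<tau> \<omega> N0 y" if y: "y \<in> {a<..b}"
    using N(3)
  proof (induction N rule: dec_induct)
    case (step N)
    have filt: "perm_config q \<tau> \<omega> N y =
        run q \<omega> (filter (\<lambda>e. a < fst e \<and> fst e < b) (ordered_labels \<tau> \<omega> N)) id y" for N
      unfolding perm_config_def by (rule run_filter_block[OF ab refl y])
    have "perm_config q \<tau> \<omega> (Suc N) y = perm_config q \<tau> \<omega> N y"
      unfolding filt using N step by (simp add: filter_ordered_labels_Suc)
    with step show ?case by simp
  qed simp
qed

text \<open>Edge 0 lies to the right of site 0 and edge -1 to its left; hence one strict and one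
  weak bound, so that site 0 belongs to \<open>{a<..b}\<close>.\<close>

definition quiet_edges :: "rings \<Rightarrow> bool" where
  "quiet_edges \<omega> \<longleftrightarrow> (\<exists>a<0. fst (\<omega> a) = 0) \<and> (\<exists>b\<ge>0. fst (\<omega> b) = 0)"

text \<open>The block around the origin is mapped onto itself, so color 0 sits at some site
  \<open>y\<close> of it, and from the first window containing both silent edges on, nothing changes
  inside.\<close>

lemma quiet_edges_stable:
  assumes "quiet_edges \<omega>"
  obtains y c where "\<forall>\<^sub>F N in sequentially. perm_config q \<tau> \<omega> N y = 0"
    and "\<forall>\<^sub>F N in sequentially. perm_config q \<tau> \<omega> N 0 = c"
proof -
  obtain a b where a: "a < 0" "fst (\<omega> a) = 0" and b: "b \<ge> 0" "fst (\<omega> b) = 0"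
    using assms by (auto simp: quiet_edges_def)
  define N0 where "N0 = nat (max (- a) b)"
  have N0: "- int N0 \<le> a" "b \<le> int N0"
    using a b by (auto simp: N0_def)
  note block = perm_config_block[where q = q and \<tau> = \<tau>, OF a(2) b(2) N0]
  have zero: "0 \<in> {a<..b}" using a b by simp
  then obtain y where y: "y \<in> {a<..b}" "perm_config q \<tau> \<omega> N0 y = 0"
    using block(1)[OF order_refl] by (metis imageE)
  show thesis
  proof (rule that)
    show "\<forall>\<^sub>F N in sequentially. perm_config q \<tau> \<omega> N y = 0"
      unfolding eventually_sequentially using block(2)[OF _ y(1)] y(2) by auto
    show "\<forall>\<^sub>F N in sequentially. perm_config q \<tau> \<omega> N 0 = perm_config q \<tau> \<omega> N0 0"
      unfolding eventually_sequentially by (intro exI[of _ N0] allI impI block(2)[OF _ zero])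
  qed
qed

lemma f2_le_iff_eventually:
  assumes "quiet_edges \<omega>"
  shows "\<forall>\<^sub>F N in sequentially.
    real_of_int (inv (perm_config q \<tau> \<omega> N) 0) \<le> x \<longleftrightarrow> real_of_int (f2 q \<tau> \<omega>) \<le> x"
proof -
  obtain y c where y: "\<forall>\<^sub>F N in sequentially. perm_config q \<tau> \<omega> N y = 0"
    using quiet_edges_stable[OF assms] .
  then have f2: "f2 q \<tau> \<omega> = y"
    by (intro f2_eq) (simp only: asep_three_eq_two_iff)
  from y show ?thesis
    by eventually_elim (metis f2 bij_perm_config bij_inv_eq_iff)
qed

lemma asep_step_eq_one_iff_eventually:
  assumes "quiet_edges \<omega>"
  shows "\<forall>\<^sub>F N in sequentially.
    real_of_int (perm_config q \<tau> \<omega> N 0) \<le> x \<longleftrightarrow> asep_config q \<tau> (eta0_step x) \<omega> 0 = 1"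
proof -
  obtain y c where c: "\<forall>\<^sub>F N in sequentially. perm_config q \<tau> \<omega> N 0 = c"
    using quiet_edges_stable[OF assms] .
  have "(\<forall>\<^sub>F N in sequentially. real_of_int (perm_config q \<tau> \<omega> N 0) \<le> x) \<longleftrightarrow>
      (\<forall>\<^sub>F N in sequentially. real_of_int c \<le> x)"
    by (rule eventually_cong) (use c in \<open>auto elim: eventually_mono\<close>)
  then have "asep_config q \<tau> (eta0_step x) \<omega> 0 = 1 \<longleftrightarrow> real_of_int c \<le> x"
    by (simp add: asep_step_eq_one_iff)
  with c show ?thesis
    by (auto elim: eventually_mono)
qed

section \<open>Resampling in product measures\<close>

text \<open>\<open>distr_pair_PiM_eq_PiM\<close> adjoins a coordinate to the index set. For
  \<open>k\<close> already in \<open>I\<close> the set stays the same and the old value is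
  overwritten by an independent copy.\<close>

lemma nn_integral_PiM_upd:
  assumes M: "\<And>i. i \<in> I \<Longrightarrow> prob_space (M i)" and k: "k \<in> I"
    and [measurable]: "g \<in> borel_measurable (PiM I M)"
  shows "(\<integral>\<^sup>+X. g X \<partial>PiM I M) = (\<integral>\<^sup>+x. \<integral>\<^sup>+X. g (X(k := x)) \<partial>PiM I M \<partial>M k)"
proof -
  interpret P: prob_space "PiM I M" by (intro prob_space_PiM M)
  have ins: "insert k I = I" using k by auto
  have [measurable]: "(\<lambda>p. (snd p)(k := fst p)) \<in> M k \<Otimes>\<^sub>M PiM I M \<rightarrow>\<^sub>M PiM I M"
    by (rule measurable_fun_upd[where J = I]) (use k in auto)
  have "(\<integral>\<^sup>+X. g X \<partial>PiM I M)
      = (\<integral>\<^sup>+X. g X \<partial>distr (M k \<Otimes>\<^sub>M PiM I M) (PiM I M) (\<lambda>(x, X). X(k := x)))"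
    using distr_pair_PiM_eq_PiM[where i' = k and I = I and M = M, OF M M[OF k]] by (simp add: ins)
  also have "\<dots> = (\<integral>\<^sup>+p. g ((snd p)(k := fst p)) \<partial>(M k \<Otimes>\<^sub>M PiM I M))"
    by (subst nn_integral_distr) (simp_all add: case_prod_unfold)
  also have "\<dots> = (\<integral>\<^sup>+x. \<integral>\<^sup>+X. g (X(k := x)) \<partial>PiM I M \<partial>M k)"
    by (subst P.nn_integral_fst[symmetric]) simp_all
  finally show ?thesis .
qed

text \<open>Replacing part of a sample from \<open>M\<close>, by means of fresh randomness from \<open>C\<close>, leaves its law
  unchanged.\<close>

definition resamples :: "'c measure \<Rightarrow> 'a measure \<Rightarrow> ('c \<Rightarrow> 'a \<Rightarrow> 'a) \<Rightarrow> bool" where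
  "resamples C M T \<longleftrightarrow>
     (\<lambda>p. T (fst p) (snd p)) \<in> C \<Otimes>\<^sub>M M \<rightarrow>\<^sub>M M \<and>
     distr (C \<Otimes>\<^sub>M M) M (\<lambda>p. T (fst p) (snd p)) = M"

lemma resamplesI:
  assumes [measurable]: "(\<lambda>p. T (fst p) (snd p)) \<in> C \<Otimes>\<^sub>M M \<rightarrow>\<^sub>M M"
    and "sigma_finite_measure M"
    and eq: "\<And>f. f \<in> borel_measurable M \<Longrightarrow>
      (\<integral>\<^sup>+c. \<integral>\<^sup>+x. f (T c x) \<partial>M \<partial>C) = (\<integral>\<^sup>+x. f x \<partial>M)"
  shows "resamples C M T"
proof -
  interpret sigma_finite_measure M by fact
  have "emeasure (distr (C \<Otimes>\<^sub>M M) M (\<lambda>p. T (fst p) (snd p))) A = emeasure M A"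
    if [measurable]: "A \<in> sets M" for A
  proof -
    have "emeasure (distr (C \<Otimes>\<^sub>M M) M (\<lambda>p. T (fst p) (snd p))) A
        = (\<integral>\<^sup>+p. indicator A (T (fst p) (snd p)) \<partial>(C \<Otimes>\<^sub>M M))"
      by (subst nn_integral_indicator[symmetric], simp, subst nn_integral_distr) simp_all
    also have "\<dots> = (\<integral>\<^sup>+c. \<integral>\<^sup>+x. indicator A (T c x) \<partial>M \<partial>C)"
      by (subst nn_integral_fst[symmetric]) simp_all
    also have "\<dots> = emeasure M A"
      by (subst eq) simp_all
    finally show ?thesis .
  qed
  then show ?thesis
    unfolding resamples_def by (intro conjI measure_eqI) simp_all
qed

lemma resamples_measurable:
  "resamples C M T \<Longrightarrow> (\<lambda>p. T (fst p) (snd p)) \<in> C \<Otimes>\<^sub>M M \<rightarrow>\<^sub>M M"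
  by (simp add: resamples_def)

lemma resamples_nn_integral:
  assumes "resamples C M T" "sigma_finite_measure M" and [measurable]: "f \<in> borel_measurable M"
  shows "(\<integral>\<^sup>+c. \<integral>\<^sup>+x. f (T c x) \<partial>M \<partial>C) = (\<integral>\<^sup>+x. f x \<partial>M)"
proof -
  interpret sigma_finite_measure M by fact
  note [measurable] = resamples_measurable[OF assms(1)]
  have "(\<integral>\<^sup>+x. f x \<partial>M) = (\<integral>\<^sup>+x. f x \<partial>distr (C \<Otimes>\<^sub>M M) M (\<lambda>p. T (fst p) (snd p)))"
    using assms(1) by (simp add: resamples_def)
  also have "\<dots> = (\<integral>\<^sup>+p. f (T (fst p) (snd p)) \<partial>(C \<Otimes>\<^sub>M M))"
    by (rule nn_integral_distr) simp_all
  also have "\<dots> = (\<integral>\<^sup>+c. \<integral>\<^sup>+x. f (T c x) \<partial>M \<partial>C)"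
    by (subst nn_integral_fst[symmetric]) simp_all
  finally show ?thesis by simp
qed

lemma resamples_const:
  assumes "prob_space M"
  shows "resamples M M (\<lambda>c x. c)"
proof -
  interpret prob_space M by fact
  show ?thesis
    by (rule resamplesI) (simp_all add: sigma_finite_measure_axioms emeasure_space_1)
qed

lemma resamples_pair_snd:
  assumes C: "prob_space C" and M: "prob_space M" and N: "prob_space N" and T: "resamples C N T"
  shows "resamples C (M \<Otimes>\<^sub>M N) (\<lambda>c x. (fst x, T c (snd x)))"
proof -
  interpret C: prob_space C by fact
  interpret M: prob_space M by fact
  interpret N: prob_space N by fact
  interpret MN: pair_prob_space M N ..
  interpret CM: pair_prob_space C M ..
  note [measurable] = resamples_measurable[OF T]
  have [measurable]: "(\<lambda>x. T (f x) (g x)) \<in> L \<rightarrow>\<^sub>M N"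
    if [measurable]: "f \<in> L \<rightarrow>\<^sub>M C" "g \<in> L \<rightarrow>\<^sub>M N" for f g L
    using measurable_compose[of "\<lambda>x. (f x, g x)", OF _ resamples_measurable[OF T]] by simp
  show ?thesis
  proof (rule resamplesI)
    fix f :: "'b \<times> 'c \<Rightarrow> ennreal" assume [measurable]: "f \<in> borel_measurable (M \<Otimes>\<^sub>M N)"
    have "(\<integral>\<^sup>+c. \<integral>\<^sup>+x. f (fst x, T c (snd x)) \<partial>(M \<Otimes>\<^sub>M N) \<partial>C)
        = (\<integral>\<^sup>+c. \<integral>\<^sup>+a. \<integral>\<^sup>+b. f (a, T c b) \<partial>N \<partial>M \<partial>C)"
      by (intro nn_integral_cong) (subst N.nn_integral_fst[symmetric], simp_all)
    \<comment> \<open>Tonelli brings the fresh randomness next to the component that it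
      modifies.\<close>
    also have "\<dots> = (\<integral>\<^sup>+a. \<integral>\<^sup>+c. \<integral>\<^sup>+b. f (a, T c b) \<partial>N \<partial>C \<partial>M)"
      by (rule CM.Fubini'[symmetric]) simp
    also have "\<dots> = (\<integral>\<^sup>+a. \<integral>\<^sup>+b. f (a, b) \<partial>N \<partial>M)"
      by (intro nn_integral_cong resamples_nn_integral[OF T]) (simp_all add: N.sigma_finite_measure_axioms)
    also have "\<dots> = (\<integral>\<^sup>+x. f x \<partial>(M \<Otimes>\<^sub>M N))"
      by (subst N.nn_integral_fst[symmetric]) simp_all
    finally show "(\<integral>\<^sup>+c. \<integral>\<^sup>+x. f (fst x, T c (snd x)) \<partial>(M \<Otimes>\<^sub>M N) \<partial>C) = (\<integral>\<^sup>+x. f x \<partial>(M \<Otimes>\<^sub>M N))" .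
  qed (simp_all add: MN.sigma_finite_measure_axioms)
qed

lemma resamples_PiM:
  assumes C: "prob_space C" and M: "\<And>i. i \<in> I \<Longrightarrow> prob_space (M i)" and k: "k \<in> I"
    and T: "resamples C (M k) T"
  shows "resamples C (PiM I M) (\<lambda>c X. X(k := T c (X k)))"
proof -
  interpret C: prob_space C by fact
  interpret Mk: prob_space "M k" by (rule M[OF k])
  interpret P: prob_space "PiM I M" by (intro prob_space_PiM M)
  have upd [measurable]: "(\<lambda>x. (g x)(k := f x)) \<in> L \<rightarrow>\<^sub>M PiM I M"
    if "f \<in> L \<rightarrow>\<^sub>M M k" "g \<in> L \<rightarrow>\<^sub>M PiM I M" for f g L
    by (rule measurable_fun_upd[where J = I]) (use k that in auto)
  have [measurable]: "(\<lambda>x. T (f x) (g x)) \<in> L \<rightarrow>\<^sub>M M k"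
    if [measurable]: "f \<in> L \<rightarrow>\<^sub>M C" "g \<in> L \<rightarrow>\<^sub>M M k" for f g L
    using measurable_compose[of "\<lambda>x. (f x, g x)", OF _ resamples_measurable[OF T]] by simp
  have [measurable]: "(\<lambda>X. X k) \<in> PiM I M \<rightarrow>\<^sub>M M k"
    using k by simp
  show ?thesis
  proof (rule resamplesI)
    fix f :: "('b \<Rightarrow> 'c) \<Rightarrow> ennreal" assume [measurable]: "f \<in> borel_measurable (PiM I M)"
    \<comment> \<open>Splitting off coordinate \<open>k\<close> exposes its value \<open>x\<close>
      to resampling; the remaining inner sample has its own entry at \<open>k\<close>
      overwritten.\<close>
    have "(\<integral>\<^sup>+c. \<integral>\<^sup>+X. f (X(k := T c (X k))) \<partial>PiM I M \<partial>C)
        = (\<integral>\<^sup>+c. \<integral>\<^sup>+x. \<integral>\<^sup>+X. f (X(k := T c x)) \<partial>PiM I M \<partial>M k \<partial>C)"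
      by (intro nn_integral_cong) (subst nn_integral_PiM_upd[OF M k], simp_all)
    also have "\<dots> = (\<integral>\<^sup>+x. \<integral>\<^sup>+X. f (X(k := x)) \<partial>PiM I M \<partial>M k)"
      by (rule resamples_nn_integral[OF T]) (simp_all add: Mk.sigma_finite_measure_axioms)
    also have "\<dots> = (\<integral>\<^sup>+X. f X \<partial>PiM I M)"
      by (rule nn_integral_PiM_upd[OF M k, symmetric]) simp_all
    finally show "(\<integral>\<^sup>+c. \<integral>\<^sup>+X. f (X(k := T c (X k))) \<partial>PiM I M \<partial>C) = (\<integral>\<^sup>+X. f X \<partial>PiM I M)" .
  qed (simp_all add: P.sigma_finite_measure_axioms)
qed

text \<open>Finite-dimensional cylinders determine the law, and the preimage of a cylinder under a
  coordinatewise map is the cylinder of the preimages.\<close>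

lemma distr_PiM:
  assumes M: "\<And>i. i \<in> I \<Longrightarrow> prob_space (M i)"
    and f [measurable]: "\<And>i. i \<in> I \<Longrightarrow> f i \<in> M i \<rightarrow>\<^sub>M N i"
  shows "distr (PiM I M) (PiM I N) (\<lambda>X. \<lambda>i\<in>I. f i (X i)) = PiM I (\<lambda>i. distr (M i) (N i) (f i))"
    (is "?L = ?R")
proof (rule measure_eqI_PiM_infinite[symmetric, where I = I and M = N])
  have D: "prob_space (distr (M i) (N i) (f i))" if "i \<in> I" for i
    using M[OF that] f[OF that] by (rule prob_space.prob_space_distr)
  show sets: "sets ?R = sets (PiM I N)"
    by (intro sets_PiM_cong) simp_all
  show "finite_measure ?R"
    by (intro prob_space.finite_measure prob_space_PiM D)
  fix J A assume J: "finite J" "J \<subseteq> I" and A [measurable]: "\<And>i. i \<in> J \<Longrightarrow> A i \<in> sets (N i)"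
  have meas: "(\<lambda>X. \<lambda>i\<in>I. f i (X i)) \<in> PiM I M \<rightarrow>\<^sub>M PiM I N"
    by (intro measurable_restrict) simp
  let ?B = "\<lambda>i. f i -` A i \<inter> space (M i)"
  have "prod_emb I (\<lambda>i. distr (M i) (N i) (f i)) J (Pi\<^sub>E J A) = prod_emb I N J (Pi\<^sub>E J A)"
    by (simp add: prod_emb_def)
  then have "emeasure ?R (prod_emb I N J (Pi\<^sub>E J A))
      = (\<Prod>i\<in>J. emeasure (distr (M i) (N i) (f i)) (A i))"
    using emeasure_PiM_emb[of I "\<lambda>i. distr (M i) (N i) (f i)" J A] D J A by simp
  also have "\<dots> = (\<Prod>i\<in>J. emeasure (M i) (?B i))"
    using J A f by (intro prod.cong emeasure_distr) auto
  also have "\<dots> = emeasure (PiM I M) (prod_emb I M J (Pi\<^sub>E J ?B))"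
    using J measurable_sets[OF f A] by (intro emeasure_PiM_emb[symmetric] M) auto
  also have "prod_emb I M J (Pi\<^sub>E J ?B)
      = (\<lambda>X. \<lambda>i\<in>I. f i (X i)) -` prod_emb I N J (Pi\<^sub>E J A) \<inter> space (PiM I M)"
    using J(2) measurable_space[OF f]
    by (auto simp: prod_emb_def space_PiM PiE_iff restrict_def extensional_def subset_iff Pi_iff)
  also have "emeasure (PiM I M) \<dots> = emeasure ?L (prod_emb I N J (Pi\<^sub>E J A))"
    using J A by (intro emeasure_distr[symmetric] meas sets_PiM_I) auto
  finally show "emeasure ?R (prod_emb I N J (Pi\<^sub>E J A)) = emeasure ?L (prod_emb I N J (Pi\<^sub>E J A))" .
qed simp

section \<open>Measurability\<close>

text \<open>The sigma-algebra of \<open>clocks\<close> does not depend on the rates, so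
  measurability is proved once here and serves the original and the reversed process.\<close>

definition ring_space :: "rings measure" where
  "ring_space = (\<Pi>\<^sub>M z\<in>UNIV. count_space UNIV \<Otimes>\<^sub>M (\<Pi>\<^sub>M i\<in>UNIV. borel \<Otimes>\<^sub>M borel))"

lemma sets_count_dist: "sets (count_dist r \<tau> z) = sets (count_space UNIV)"
  by (simp add: count_dist_def)

lemma sets_time_dist: "sets (time_dist r \<tau> z) = sets borel"
  by (simp add: time_dist_def)

lemma sets_clocks: "sets (clocks r \<tau>) = sets ring_space"
  unfolding clocks_def ring_space_def site_clock_def
  by (intro sets_PiM_cong sets_pair_measure_cong)
     (simp_all add: sets_count_dist sets_time_dist)

lemma measurable_clocks_eq: "measurable (clocks r \<tau>) M = measurable ring_space M"
  by (intro measurable_cong_sets sets_clocks refl)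

lemma space_clocks: "space (clocks r \<tau>) = UNIV"
  by (simp add: sets_eq_imp_space_eq[OF sets_clocks] ring_space_def space_PiM space_pair_measure)

lemma measurable_fst_ring_space [measurable]:
  "(\<lambda>\<omega>. fst (\<omega> z)) \<in> ring_space \<rightarrow>\<^sub>M count_space UNIV"
  unfolding ring_space_def by measurable

lemma borel_measurable_ring_time [measurable]: "(\<lambda>\<omega>. ring_time \<omega> e) \<in> borel_measurable ring_space"
  unfolding ring_time_def ring_space_def by measurable

lemma borel_measurable_ring_coin [measurable]: "(\<lambda>\<omega>. ring_coin \<omega> e) \<in> borel_measurable ring_space"
  unfolding ring_coin_def ring_space_def by measurable

lemma measurable_count_space_binary:
  fixes f :: "'a \<Rightarrow> 'b::countable" and g :: "'a \<Rightarrow> 'c::countable"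
  assumes [measurable]: "f \<in> M \<rightarrow>\<^sub>M count_space UNIV" "g \<in> M \<rightarrow>\<^sub>M count_space UNIV"
  shows "(\<lambda>x. h (f x) (g x)) \<in> M \<rightarrow>\<^sub>M count_space UNIV"
proof (rule measurable_compose_countable[where f = "\<lambda>y x. h y (g x)"])
  show "(\<lambda>x. h y (g x)) \<in> M \<rightarrow>\<^sub>M count_space UNIV" for y
    by (rule measurable_compose[OF assms(2)]) simp
qed fact

lemma measurable_ring_labels [measurable]:
  "(\<lambda>\<omega>. ring_labels \<omega> zs) \<in> ring_space \<rightarrow>\<^sub>M count_space UNIV"
proof (induction zs)
  case (Cons z zs)
  have "(\<lambda>\<omega>. map (Pair z) [0..<fst (\<omega> z)] @ ring_labels \<omega> zs) \<in> ring_space \<rightarrow>\<^sub>M count_space UNIV"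
    by (rule measurable_count_space_binary[where h = "\<lambda>n ys. map (Pair z) [0..<n] @ ys"])
       (use Cons in simp_all)
  then show ?case by (simp add: ring_labels_def)
qed (simp add: ring_labels_def)

lemma measurable_filter_const:
  fixes xs :: "'b::countable list"
  assumes [measurable]: "\<And>y. Measurable.pred M (\<lambda>x. P x y)"
  shows "(\<lambda>x. filter (P x) xs) \<in> M \<rightarrow>\<^sub>M count_space UNIV"
proof (induction xs)
  case (Cons y xs)
  note [measurable] = Cons measurable_compose[OF Cons, of "(#) y" "count_space UNIV", simplified]
  show ?case by simp
qed simp

lemma measurable_insort_key_const:
  fixes ys :: "'b::countable list" and k :: "'a \<Rightarrow> 'b \<Rightarrow> real"
  assumes [measurable]: "\<And>y. (\<lambda>x. k x y) \<in> borel_measurable M"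
  shows "(\<lambda>x. insort_key (k x) z ys) \<in> M \<rightarrow>\<^sub>M count_space UNIV"
proof (induction ys)
  case (Cons y ys)
  note [measurable] = measurable_compose[OF Cons, of "(#) y" "count_space UNIV", simplified]
  show ?case by simp
qed simp

lemma measurable_sort_key_const:
  fixes xs :: "'b::countable list" and k :: "'a \<Rightarrow> 'b \<Rightarrow> real"
  assumes "\<And>y. (\<lambda>x. k x y) \<in> borel_measurable M"
  shows "(\<lambda>x. sort_key (k x) xs) \<in> M \<rightarrow>\<^sub>M count_space UNIV"
proof (induction xs)
  case (Cons y xs)
  have "(\<lambda>x. insort_key (k x) y (sort_key (k x) xs)) \<in> M \<rightarrow>\<^sub>M count_space UNIV"
    by (rule measurable_compose_countable[OF measurable_insort_key_const[OF assms] Cons])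
  then show ?case by simp
qed simp

text \<open>Label lists take countably many values. With the input list frozen, filtering and
  sorting depend on finitely many comparisons of ring times.\<close>

lemma measurable_ordered_labels [measurable]:
  "(\<lambda>\<omega>. ordered_labels \<tau> \<omega> N) \<in> ring_space \<rightarrow>\<^sub>M count_space UNIV"
  unfolding ordered_labels_def
proof (rule measurable_compose_countable[OF measurable_sort_key_const])
  have "(\<lambda>\<omega>. filter (\<lambda>e. ring_time \<omega> e \<le> \<tau>) xs) \<in> ring_space \<rightarrow>\<^sub>M count_space UNIV" for xs
    by (rule measurable_filter_const) measurable
  then show "(\<lambda>\<omega>. filter (\<lambda>e. ring_time \<omega> e \<le> \<tau>) (ring_labels \<omega> [- int N..int N]))
      \<in> ring_space \<rightarrow>\<^sub>M count_space UNIV"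
    by (rule measurable_compose_countable) measurable
qed measurable

lemma swap_step_if_coin:
  "swap_step q z U w =
    (if w z < w (z + 1) \<or> U < q then (if w z = w (z + 1) then w else w \<circ> adj_transp z) else w)"
  by (auto simp: swap_step_def)

text \<open>\<open>P\<close> may be arbitrary: for fixed \<open>L\<close> and \<open>w\<close> the
  outcome is decided by finitely many comparisons of coins with \<open>q\<close>.\<close>

lemma pred_run [measurable]: "Measurable.pred ring_space (\<lambda>\<omega>. P (run q \<omega> L w))"
proof (induction L arbitrary: w)
  case (Cons e L)
  have "Measurable.pred ring_space (\<lambda>\<omega>. if w (fst e) < w (fst e + 1) \<or> ring_coin \<omega> e < q
      then P (run q \<omega> L (if w (fst e) = w (fst e + 1) then w else w \<circ> adj_transp (fst e)))
      else P (run q \<omega> L w))"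
    using Cons[of "if w (fst e) = w (fst e + 1) then w else w \<circ> adj_transp (fst e)"] Cons[of w]
    by measurable
  moreover have "P (run q \<omega> (e # L) w) = (if w (fst e) < w (fst e + 1) \<or> ring_coin \<omega> e < q
      then P (run q \<omega> L (if w (fst e) = w (fst e + 1) then w else w \<circ> adj_transp (fst e)))
      else P (run q \<omega> L w))" for \<omega>
    by (simp only: run_Cons swap_step_if_coin) simp
  ultimately show ?case by simp
qed simp

lemma pred_perm_config [measurable]:
  "Measurable.pred ring_space (\<lambda>\<omega>. P (perm_config q \<tau> \<omega> N))"
  unfolding perm_config_def by (rule measurable_compose_countable) measurable

lemma pred_asep_three_eq_two [measurable]:
  "Measurable.pred ring_space (\<lambda>\<omega>. asep_config q \<tau> eta0_three \<omega> y = 2)"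
  unfolding asep_three_eq_two_iff eventually_sequentially by measurable

text \<open>\<open>f2_le_iff\<close> replaces the definite description by countable set operations
  on measurable events.\<close>

lemma pred_f2_le [measurable]: "Measurable.pred ring_space (\<lambda>\<omega>. real_of_int (f2 q \<tau> \<omega>) \<le> x)"
  unfolding f2_le_iff by measurable

lemma pred_asep_step_eq_one [measurable]:
  "Measurable.pred ring_space (\<lambda>\<omega>. asep_config q \<tau> (eta0_step x) \<omega> y = 1)"
  unfolding asep_step_eq_one_iff eventually_sequentially by measurable

section \<open>The ring processes\<close>

text \<open>These conditions are stable under time reversal. The bounds are restricted to
  \<open>[0, \<tau>]\<close> because for \<open>u > \<tau>\<close> the reversed rate reads
  \<open>r\<close> at negative times, and measurability stands in for piecewise continuity.\<close>

locale asep_rates =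
  fixes r :: "int \<Rightarrow> real \<Rightarrow> real" and \<tau> C :: real
  assumes time_nonneg: "0 \<le> \<tau>"
    and rate_bounds: "0 \<le> u \<Longrightarrow> u \<le> \<tau> \<Longrightarrow> 0 \<le> r z u \<and> r z u \<le> C"
    and rate_measurable: "(\<lambda>u. indicator {0..\<tau>} u * r z u) \<in> borel_measurable borel"
begin

lemma rate_indicator_nonneg: "0 \<le> indicator {0..\<tau>} u * r z u"
  using rate_bounds[of u z] by (auto simp: indicator_def)

lemma integrable_rate: "integrable lborel (\<lambda>u. indicator {0..\<tau>} u * r z u)"
proof (rule Bochner_Integration.integrable_bound)
  show "integrable lborel (\<lambda>u. indicator {0..\<tau>} u * C)"
    using time_nonneg by (intro integrable_mult_left integrable_real_indicator) simp_all
  show "AE u in lborel. norm (indicator {0..\<tau>} u * r z u) \<le> norm (indicator {0..\<tau>} u * C)"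
    using rate_bounds[of _ z] by (intro AE_I2) (force simp: indicator_def)
qed (use rate_measurable in simp)

lemma clock_mass_eq: "clock_mass r \<tau> z = (\<integral>u. indicator {0..\<tau>} u * r z u \<partial>lborel)"
  using interval_integral_Icc[OF time_nonneg, of "r z"]
  by (simp add: clock_mass_def set_lebesgue_integral_def flip: zero_ereal_def)

text \<open>Uniform in \<open>z\<close>, this bounds the probability of a silent edge away from
  0.\<close>

lemma clock_mass_le: "clock_mass r \<tau> z \<le> C * \<tau>"
proof -
  have "clock_mass r \<tau> z \<le> (\<integral>u. indicator {0..\<tau>} u * C \<partial>lborel)"
    unfolding clock_mass_eq
  proof (rule integral_mono[OF integrable_rate])
    show "integrable lborel (\<lambda>u. indicator {0..\<tau>} u * C)"
      using time_nonneg by (intro integrable_mult_left integrable_real_indicator) simp_all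
  qed (use rate_bounds in \<open>auto simp: indicator_def\<close>)
  also have "\<dots> = C * \<tau>"
    using time_nonneg by simp
  finally show ?thesis .
qed

lemma bound_times_time_nonneg: "0 \<le> C * \<tau>"
  using rate_bounds[of 0 0] time_nonneg by simp

lemma prob_space_time_dist: "prob_space (time_dist r \<tau> z)"
proof (cases "0 < clock_mass r \<tau> z")
  case True
  let ?f = "\<lambda>u. indicator {0..\<tau>} u * r z u / clock_mass r \<tau> z"
  have "emeasure (time_dist r \<tau> z) (space (time_dist r \<tau> z)) = (\<integral>\<^sup>+u. ennreal (?f u) \<partial>lborel)"
    using True rate_measurable[of z] by (simp add: time_dist_def emeasure_density)
  also have "\<dots> = ennreal (\<integral>u. ?f u \<partial>lborel)"
    using True rate_indicator_nonneg[of _ z]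
    by (intro nn_integral_eq_integral integrable_divide_zero integrable_rate) auto
  also have "\<dots> = 1"
    using True by (simp add: clock_mass_eq)
  finally show ?thesis by (rule prob_spaceI)
next
  case False
  then show ?thesis by (simp add: time_dist_def prob_space_return)
qed

lemma AE_time_dist:
  assumes "0 < clock_mass r \<tau> z" and "AE t in lborel. t \<in> {0..\<tau>} \<longrightarrow> P t"
  shows "AE t in time_dist r \<tau> z. P t"
proof -
  have "time_dist r \<tau> z = density lborel (\<lambda>u. ennreal (indicator {0..\<tau>} u * r z u / clock_mass r \<tau> z))"
    using assms(1) by (simp add: time_dist_def)
  moreover have "(\<lambda>u. ennreal (indicator {0..\<tau>} u * r z u / clock_mass r \<tau> z)) \<in> borel_measurable lborel"
    using rate_measurable[of z] by simp
  moreover have "AE t in lborel. 0 < ennreal (indicator {0..\<tau>} t * r z t / clock_mass r \<tau> z) \<longrightarrow> P t"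
    using assms(2) by eventually_elim (auto simp: indicator_def split: if_splits)
  ultimately show ?thesis by (simp only: AE_density)
qed

lemma AE_time_dist_Icc: "0 < clock_mass r \<tau> z \<Longrightarrow> AE t in time_dist r \<tau> z. t \<in> {0..\<tau>}"
  by (rule AE_time_dist) simp_all

lemma AE_time_dist_neq:
  assumes "0 < clock_mass r \<tau> z"
  shows "AE t in time_dist r \<tau> z. t \<noteq> s"
  by (rule AE_time_dist[OF assms]) (use AE_lborel_singleton[of s] in eventually_elim, simp)

abbreviation "coin_dist \<equiv> uniform_measure lborel {0..1::real}"

lemma prob_space_coin_dist: "prob_space coin_dist"
  by (rule prob_space_uniform_measure) auto

lemma prob_space_count_dist: "prob_space (count_dist r \<tau> z)"
  by (simp add: count_dist_def prob_space_measure_pmf)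

lemma prob_space_ring: "prob_space (time_dist r \<tau> z \<Otimes>\<^sub>M coin_dist)"
  by (intro prob_space_pair prob_space_time_dist prob_space_coin_dist)

lemma prob_space_site_clock: "prob_space (site_clock r \<tau> z)"
  unfolding site_clock_def
  by (intro prob_space_pair prob_space_count_dist prob_space_PiM prob_space_ring)

lemma prob_space_clocks: "prob_space (clocks r \<tau>)"
  unfolding clocks_def by (intro prob_space_PiM prob_space_site_clock)

lemma coin_dist_less:
  assumes "0 \<le> q" "q \<le> 1"
  shows "measure coin_dist {..<q} = q"
proof -
  have "{0..1} \<inter> {..<q} = {0..<q}" using assms by auto
  then show ?thesis
    using assms by (subst measure_uniform_measure) simp_all
qed

text \<open>The maximum unifies the Poisson count with the degenerate one, which is 0 with
  probability one.\<close>

lemma emeasure_count_dist_0: "emeasure (count_dist r \<tau> z) {0} = ennreal (exp (- max 0 (clock_mass r \<tau> z)))"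
  by (auto simp: count_dist_def emeasure_pmf_single max_def)

section \<open>Fresh coins and the average of a run over its coins\<close>

lemma resamples_clocks:
  assumes "prob_space K" "resamples K (time_dist r \<tau> z \<Otimes>\<^sub>M coin_dist) T"
  shows "resamples K (clocks r \<tau>)
    (\<lambda>c X. X(z := (fst (X z), (snd (X z))(i := T c (snd (X z) i)))))"
proof -
  have "resamples K (\<Pi>\<^sub>M i\<in>UNIV. time_dist r \<tau> z \<Otimes>\<^sub>M coin_dist) (\<lambda>c X. X(i := T c (X i)))"
    by (intro resamples_PiM prob_space_ring assms) simp
  then have "resamples K (site_clock r \<tau> z) (\<lambda>c x. (fst x, (snd x)(i := T c (snd x i))))"
    unfolding site_clock_def
    by (intro resamples_pair_snd[where T = "\<lambda>c X. X(i := T c (X i))"] assms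
        prob_space_count_dist prob_space_PiM prob_space_ring)
  then show ?thesis
    unfolding clocks_def
    by (intro resamples_PiM[where T = "\<lambda>c x. (fst x, (snd x)(i := T c (snd x i)))"]
        prob_space_site_clock assms) simp
qed

lemma resamples_ring_coin: "resamples coin_dist (time_dist r \<tau> z \<Otimes>\<^sub>M coin_dist) (\<lambda>c x. (fst x, c))"
  using resamples_pair_snd[OF prob_space_coin_dist prob_space_time_dist prob_space_coin_dist
      resamples_const[OF prob_space_coin_dist]] .

definition set_coin :: "int \<times> nat \<Rightarrow> real \<Rightarrow> rings \<Rightarrow> rings" where
  "set_coin e c X = X(fst e := (fst (X (fst e)), (snd (X (fst e)))
     (snd e := (fst (snd (X (fst e)) (snd e)), c))))"

lemma resamples_set_coin: "resamples coin_dist (clocks r \<tau>) (set_coin e)"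
  using resamples_clocks[OF prob_space_coin_dist resamples_ring_coin, of "fst e" "snd e"]
  unfolding set_coin_def by simp

lemma ring_coin_set_coin: "ring_coin (set_coin e c \<omega>) e' = (if e' = e then c else ring_coin \<omega> e')"
  by (cases e; cases e') (auto simp: ring_coin_def set_coin_def)

text \<open>Invariance under \<open>set_coin e\<close> says that \<open>D\<close> ignores the coin
  of \<open>e\<close>. Replacing that coin by a fresh one turns the event into the rectangle
  \<open>{..<q} \<times> D\<close>.\<close>

lemma measure_coin_less:
  assumes q: "0 \<le> q" "q \<le> 1" and D: "D \<in> sets (clocks r \<tau>)"
    and inv: "\<And>\<omega> c. set_coin e c \<omega> \<in> D \<longleftrightarrow> \<omega> \<in> D"
  shows "measure (clocks r \<tau>) {\<omega> \<in> D. ring_coin \<omega> e < q} = q * measure (clocks r \<tau>) D"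
proof -
  interpret M: prob_space "clocks r \<tau>" by (rule prob_space_clocks)
  let ?T = "\<lambda>p. set_coin e (fst p) (snd p)"
  let ?A = "{\<omega> \<in> D. ring_coin \<omega> e < q}"
  have [measurable]: "(\<lambda>\<omega>. ring_coin \<omega> e) \<in> borel_measurable (clocks r \<tau>)"
    by (simp add: measurable_clocks_eq)
  note [measurable] = D
  have A: "?A \<in> sets (clocks r \<tau>)"
  proof -
    have "?A = D \<inter> {\<omega> \<in> space (clocks r \<tau>). ring_coin \<omega> e < q}"
      by (auto simp: space_clocks)
    then show ?thesis by simp
  qed
  have "measure (clocks r \<tau>) ?A = measure (distr (coin_dist \<Otimes>\<^sub>M clocks r \<tau>) (clocks r \<tau>) ?T) ?A"
    using resamples_set_coin[of e] by (simp add: resamples_def)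
  also have "\<dots> = measure (coin_dist \<Otimes>\<^sub>M clocks r \<tau>) ({..<q} \<times> D)"
    by (subst measure_distr)
       (auto intro!: arg_cong[where f = "measure _"] resamples_measurable[OF resamples_set_coin] A
         simp: ring_coin_set_coin inv space_pair_measure space_clocks)
  also have "\<dots> = q * measure (clocks r \<tau>) D"
    unfolding measure_def
    by (subst M.emeasure_pair_measure_Times)
       (simp_all only: enn2real_mult coin_dist_less[OF q, unfolded measure_def] D, simp)
  finally show ?thesis .
qed

lemma measure_coin_not_less:
  assumes q: "0 \<le> q" "q \<le> 1" and D: "D \<in> sets (clocks r \<tau>)"
    and inv: "\<And>\<omega> c. set_coin e c \<omega> \<in> D \<longleftrightarrow> \<omega> \<in> D"
  shows "measure (clocks r \<tau>) {\<omega> \<in> D. \<not> ring_coin \<omega> e < q} = (1 - q) * measure (clocks r \<tau>) D"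
proof -
  interpret M: prob_space "clocks r \<tau>" by (rule prob_space_clocks)
  have [measurable]: "(\<lambda>\<omega>. ring_coin \<omega> e) \<in> borel_measurable (clocks r \<tau>)"
    by (simp add: measurable_clocks_eq)
  have "{\<omega> \<in> D. ring_coin \<omega> e < q} = D \<inter> {\<omega> \<in> space (clocks r \<tau>). ring_coin \<omega> e < q}"
    by (auto simp: space_clocks)
  with D have "{\<omega> \<in> D. ring_coin \<omega> e < q} \<in> sets (clocks r \<tau>)" by simp
  then have "measure (clocks r \<tau>) (D - {\<omega> \<in> D. ring_coin \<omega> e < q})
      = measure (clocks r \<tau>) D - q * measure (clocks r \<tau>) D"
    using D by (subst M.finite_measure_Diff) (auto simp: measure_coin_less[OF assms])
  moreover have "D - {\<omega> \<in> D. ring_coin \<omega> e < q} = {\<omega> \<in> D. \<not> ring_coin \<omega> e < q}"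
    by auto
  ultimately show ?thesis by (simp add: left_diff_distrib)
qed

text \<open>Each step splits \<open>D\<close> according to the coin just used. As the labels are
  distinct, the smaller event still ignores all later coins, so the induction has to run over all
  such \<open>D\<close>.\<close>

lemma measure_run:
  assumes q: "0 \<le> q" "q \<le> 1" and "distinct L" and "D \<in> sets (clocks r \<tau>)"
    and "\<And>e \<omega> c. e \<in> set L \<Longrightarrow> set_coin e c \<omega> \<in> D \<longleftrightarrow> \<omega> \<in> D"
  shows "measure (clocks r \<tau>) {\<omega> \<in> D. P (run q \<omega> L w)}
    = measure (clocks r \<tau>) D * foldr (swap_op q) (map fst L) (\<lambda>w. of_bool (P w)) w"
  using assms(3-)
proof (induction L arbitrary: w D)
  case (Cons e L)
  interpret M: prob_space "clocks r \<tau>" by (rule prob_space_clocks)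
  have [measurable]: "(\<lambda>\<omega>. ring_coin \<omega> e) \<in> borel_measurable (clocks r \<tau>)"
    by (simp add: measurable_clocks_eq)
  have [measurable]: "Measurable.pred (clocks r \<tau>) (\<lambda>\<omega>. P (run q \<omega> L w))" for w
    by (simp add: measurable_clocks_eq)
  note [measurable] = \<open>D \<in> sets (clocks r \<tau>)\<close>
  have in_sets: "{\<omega> \<in> D. Q \<omega>} \<in> sets (clocks r \<tau>)" if [measurable]: "Measurable.pred (clocks r \<tau>) Q" for Q
  proof -
    have "{\<omega> \<in> D. Q \<omega>} = D \<inter> {\<omega> \<in> space (clocks r \<tau>). Q \<omega>}"
      by (auto simp: space_clocks)
    then show ?thesis by simp
  qed
  let ?z = "fst e"
  let ?E = "\<lambda>w. foldr (swap_op q) (map fst L) (\<lambda>w. of_bool (P w)) w"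
  have e: "e \<notin> set L" and L: "distinct L" using Cons.prems by auto
  \<comment> \<open>\<open>Q\<close> covers the three uses: no condition when the swap is certain,
    and the two outcomes of the coin otherwise.\<close>
  have IH: "measure (clocks r \<tau>) {\<omega> \<in> {\<omega> \<in> D. Q (ring_coin \<omega> e)}. P (run q \<omega> L w)}
      = measure (clocks r \<tau>) {\<omega> \<in> D. Q (ring_coin \<omega> e)} * ?E w"
    if Q: "Measurable.pred borel Q" for w Q
  proof (rule Cons.IH[OF L])
    note [measurable] = Q
    show "{\<omega> \<in> D. Q (ring_coin \<omega> e)} \<in> sets (clocks r \<tau>)"
      by (rule in_sets) measurable
  next
    fix e' \<omega> c assume "e' \<in> set L"
    then show "set_coin e' c \<omega> \<in> {\<omega> \<in> D. Q (ring_coin \<omega> e)} \<longleftrightarrow> \<omega> \<in> {\<omega> \<in> D. Q (ring_coin \<omega> e)}"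
      using e Cons.prems(3)[of e'] by (auto simp: ring_coin_set_coin)
  qed
  have coin: "measure (clocks r \<tau>) {\<omega> \<in> D. ring_coin \<omega> e < q} = q * measure (clocks r \<tau>) D"
    "measure (clocks r \<tau>) {\<omega> \<in> D. \<not> ring_coin \<omega> e < q} = (1 - q) * measure (clocks r \<tau>) D"
    using measure_coin_less[OF q Cons.prems(2)] measure_coin_not_less[OF q Cons.prems(2)] Cons.prems(3)
    by auto
  show ?case
  proof (cases "w ?z < w (?z + 1)")
    case True
    then have "{\<omega> \<in> D. P (run q \<omega> (e # L) w)} = {\<omega> \<in> {\<omega> \<in> D. True}. P (run q \<omega> L (w \<circ> adj_transp ?z))}"
      by (simp add: swap_step_def)
    then have "measure (clocks r \<tau>) {\<omega> \<in> D. P (run q \<omega> (e # L) w)}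
        = measure (clocks r \<tau>) D * ?E (w \<circ> adj_transp ?z)"
      using IH[of "\<lambda>_. True"] by simp
    with True show ?thesis
      by (simp add: swap_op_def[of _ ?z])
  next
    case False
    \<comment> \<open>Equal colors fit the same formula, since exchanging them leaves
      \<open>w\<close> unchanged.\<close>
    have step: "swap_step q ?z U w = (if U < q then w \<circ> adj_transp ?z else w)" for U
      using False by (cases "w ?z = w (?z + 1)") (auto simp: swap_step_def comp_adj_transp)
    let ?A = "{\<omega> \<in> {\<omega> \<in> D. ring_coin \<omega> e < q}. P (run q \<omega> L (w \<circ> adj_transp ?z))}"
    let ?B = "{\<omega> \<in> {\<omega> \<in> D. \<not> ring_coin \<omega> e < q}. P (run q \<omega> L w)}"
    have "?A = {\<omega> \<in> D. ring_coin \<omega> e < q \<and> P (run q \<omega> L (w \<circ> adj_transp ?z))}"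
      "?B = {\<omega> \<in> D. \<not> ring_coin \<omega> e < q \<and> P (run q \<omega> L w)}"
      by auto
    then have sets: "?A \<in> sets (clocks r \<tau>)" "?B \<in> sets (clocks r \<tau>)"
      using in_sets by simp_all
    have "{\<omega> \<in> D. P (run q \<omega> (e # L) w)} = ?A \<union> ?B"
      by (auto simp: step)
    then have "measure (clocks r \<tau>) {\<omega> \<in> D. P (run q \<omega> (e # L) w)}
        = measure (clocks r \<tau>) ?A + measure (clocks r \<tau>) ?B"
      using sets by (simp only:) (intro M.finite_measure_Union, auto)
    also have "\<dots> = q * measure (clocks r \<tau>) D * ?E (w \<circ> adj_transp ?z)
        + (1 - q) * measure (clocks r \<tau>) D * ?E w"
      using IH[of "\<lambda>c. c < q"] IH[of "\<lambda>c. \<not> c < q"] coin by simp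
    finally show ?thesis
      using False by (simp add: swap_op_def[of _ ?z] distrib_left mult_ac)
  qed
qed simp

end

text \<open>By Fubini an almost sure property may be checked with the fresh value held
  fixed.\<close>

lemma AE_resamples:
  assumes T: "resamples K M T" and "prob_space K" "prob_space M"
    and [measurable]: "Measurable.pred M P"
    and AE: "AE c in K. AE x in M. P (T c x)"
  shows "AE x in M. P x"
proof -
  interpret K: prob_space K by fact
  interpret M: prob_space M by fact
  interpret pair_prob_space K M ..
  note [measurable] = resamples_measurable[OF T]
  have "AE p in K \<Otimes>\<^sub>M M. P (T (fst p) (snd p))"
    by (rule AE_pair_measure) (use AE in simp_all)
  then have "AE x in distr (K \<Otimes>\<^sub>M M) M (\<lambda>p. T (fst p) (snd p)). P x"
    by (subst AE_distr_iff) simp_all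
  moreover have "distr (K \<Otimes>\<^sub>M M) M (\<lambda>p. T (fst p) (snd p)) = M"
    using T by (simp add: resamples_def)
  ultimately show ?thesis by (simp only:)
qed

lemma AE_pair_fst:
  assumes "prob_space M" "prob_space N" and [measurable]: "Measurable.pred M P"
    and "AE x in M. P x"
  shows "AE p in M \<Otimes>\<^sub>M N. P (fst p)"
proof -
  interpret M: prob_space M by fact
  interpret N: prob_space N by fact
  interpret pair_prob_space M N ..
  show ?thesis
    by (rule AE_pair_measure) (use assms(4) in simp_all)
qed

lemma nn_integral_count_space_point:
  fixes f :: "'a \<Rightarrow> ennreal"
  assumes "\<And>x. x \<noteq> a \<Longrightarrow> f x = 0"
  shows "(\<integral>\<^sup>+x. f x \<partial>count_space UNIV) = f a"
  using nn_integral_count_space'[of "{a}" UNIV f] assms by simp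

section \<open>Law of the packed process in a finite window\<close>

context asep_rates
begin

interpretation clk: prob_space "clocks r \<tau>" by (rule prob_space_clocks)

lemma pred_clocks: "Measurable.pred ring_space P \<Longrightarrow> Measurable.pred (clocks r \<tau>) P"
  by (simp add: measurable_clocks_eq)

lemma ordered_labels_set_coin: "ordered_labels \<tau>' (set_coin e c \<omega>) N = ordered_labels \<tau>' \<omega> N"
proof -
  have 1: "ring_time (set_coin e c \<omega>) = ring_time \<omega>"
    by (auto simp: fun_eq_iff ring_time_def set_coin_def)
  have 2: "fst (set_coin e c \<omega> z) = fst (\<omega> z)" for z
    by (simp add: set_coin_def)
  show ?thesis
    by (simp add: ordered_labels_def ring_labels_def 1 2)
qed

text \<open>The space splits into the countably many events \<open>D L\<close>, which constrain
  counts and times but no coin, so \<open>measure_run\<close> applies to each of them.\<close>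

lemma emeasure_perm_config:
  assumes q: "0 \<le> q" "q \<le> 1"
  shows "emeasure (clocks r \<tau>) {\<omega> \<in> space (clocks r \<tau>). P (perm_config q \<tau> \<omega> N)}
    = (\<integral>\<^sup>+\<omega>. ennreal (foldr (swap_op q) (map fst (ordered_labels \<tau> \<omega> N)) (\<lambda>w. of_bool (P w)) id)
        \<partial>clocks r \<tau>)"
proof -
  let ?M = "clocks r \<tau>" and ?l = "\<lambda>\<omega>. ordered_labels \<tau> \<omega> N"
  let ?E = "\<lambda>L. foldr (swap_op q) (map fst L) (\<lambda>w. of_bool (P w)) id"
  define D where "D L = {\<omega>. ?l \<omega> = L}" for L
  define R where "R L = {\<omega> \<in> D L. P (run q \<omega> L id)}" for L
  have [measurable]: "?l \<in> ?M \<rightarrow>\<^sub>M count_space UNIV"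
    by (simp add: measurable_clocks_eq)
  have D [measurable]: "D L \<in> sets ?M" for L
  proof -
    have "D L = {\<omega> \<in> space ?M. ?l \<omega> = L}" by (simp add: space_clocks D_def)
    then show ?thesis by simp
  qed
  have [measurable]: "R L \<in> sets ?M" for L
  proof -
    have [measurable]: "Measurable.pred ?M (\<lambda>\<omega>. P (run q \<omega> L id))"
      by (simp add: measurable_clocks_eq)
    have "R L = D L \<inter> {\<omega> \<in> space ?M. P (run q \<omega> L id)}"
      by (auto simp: space_clocks R_def)
    then show ?thesis by simp
  qed
  have [measurable]: "Measurable.pred ?M (\<lambda>\<omega>. P (perm_config q \<tau> \<omega> N))"
    by (simp add: measurable_clocks_eq)
  have run: "emeasure ?M (R L) = emeasure ?M (D L) * ennreal (?E L)" for L
  proof (cases "distinct L")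
    case True
    have "measure ?M (R L) = measure ?M (D L) * ?E L"
      unfolding R_def
      by (rule measure_run[OF q True D]) (simp add: D_def ordered_labels_set_coin)
    then show ?thesis
      by (simp add: clk.emeasure_eq_measure ennreal_mult')
  next
    case False
    \<comment> \<open>A list with repetitions never arises as a list of ordered labels.\<close>
    then have "D L = {}" "R L = {}" using distinct_ordered_labels by (auto simp: D_def R_def)
    then show ?thesis by simp
  qed
  have "emeasure ?M {\<omega> \<in> space ?M. P (perm_config q \<tau> \<omega> N)}
      = (\<integral>\<^sup>+\<omega>. indicator {\<omega> \<in> space ?M. P (perm_config q \<tau> \<omega> N)} \<omega> \<partial>?M)"
    by simp
  \<comment> \<open>The sum over lists is an integral over \<open>count_space\<close>, with a single
    nonzero candidate for each \<omega>: its own list of labels.\<close>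
  also have "\<dots> = (\<integral>\<^sup>+\<omega>. \<integral>\<^sup>+L. indicator (R L) \<omega> \<partial>count_space UNIV \<partial>?M)"
  proof (rule nn_integral_cong)
    fix \<omega>
    show "indicator {\<omega> \<in> space ?M. P (perm_config q \<tau> \<omega> N)} \<omega>
        = (\<integral>\<^sup>+L. indicator (R L) \<omega> \<partial>count_space UNIV)"
      by (subst nn_integral_count_space_point[where a = "?l \<omega>"])
         (auto simp: indicator_def perm_config_def space_clocks R_def D_def)
  qed
  also have "\<dots> = (\<integral>\<^sup>+L. \<integral>\<^sup>+\<omega>. indicator (R L) \<omega> \<partial>?M \<partial>count_space UNIV)"
    by (rule nn_integral_count_space_nn_integral) simp_all
  also have "\<dots> = (\<integral>\<^sup>+L. \<integral>\<^sup>+\<omega>. indicator (D L) \<omega> * ennreal (?E L) \<partial>?M \<partial>count_space UNIV)"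
    by (rule nn_integral_cong) (simp add: run nn_integral_multc)
  also have "\<dots> = (\<integral>\<^sup>+\<omega>. \<integral>\<^sup>+L. indicator (D L) \<omega> * ennreal (?E L) \<partial>count_space UNIV \<partial>?M)"
    by (rule nn_integral_count_space_nn_integral[symmetric]) simp_all
  also have "\<dots> = (\<integral>\<^sup>+\<omega>. ennreal (?E (?l \<omega>)) \<partial>?M)"
  proof (rule nn_integral_cong)
    fix \<omega>
    show "(\<integral>\<^sup>+L. indicator (D L) \<omega> * ennreal (?E L) \<partial>count_space UNIV) = ennreal (?E (?l \<omega>))"
      by (subst nn_integral_count_space_point[where a = "?l \<omega>"]) (simp_all add: indicator_def D_def)
  qed
  finally show ?thesis .
qed

section \<open>Almost sure properties of the ring times\<close>

definition set_ring :: "int \<times> nat \<Rightarrow> real \<times> real \<Rightarrow> rings \<Rightarrow> rings" where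
  "set_ring e c X = X(fst e := (fst (X (fst e)), (snd (X (fst e)))(snd e := c)))"

lemma ring_time_set_ring: "ring_time (set_ring e c \<omega>) e' = (if e' = e then fst c else ring_time \<omega> e')"
  by (cases e; cases e') (auto simp: ring_time_def set_ring_def)

lemma resamples_set_ring:
  "resamples (time_dist r \<tau> (fst e) \<Otimes>\<^sub>M coin_dist) (clocks r \<tau>) (set_ring e)"
  using resamples_clocks[OF prob_space_ring resamples_const[OF prob_space_ring], of "fst e" "snd e"]
  unfolding set_ring_def by simp

lemma AE_ring_time:
  assumes [measurable]: "Measurable.pred borel P" and "AE t in time_dist r \<tau> (fst e). P t"
  shows "AE \<omega> in clocks r \<tau>. P (ring_time \<omega> e)"
proof (rule AE_resamples[OF resamples_set_ring])
  show "Measurable.pred (clocks r \<tau>) (\<lambda>\<omega>. P (ring_time \<omega> e))"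
    by (rule pred_clocks) measurable
  have "Measurable.pred (time_dist r \<tau> (fst e)) P"
    using assms(1) by (simp add: measurable_cong_sets[OF sets_time_dist refl])
  then have "AE c in time_dist r \<tau> (fst e) \<Otimes>\<^sub>M coin_dist. P (fst c)"
    by (intro AE_pair_fst assms prob_space_time_dist prob_space_coin_dist)
  then show "AE c in time_dist r \<tau> (fst e) \<Otimes>\<^sub>M coin_dist. AE \<omega> in clocks r \<tau>.
      P (ring_time (set_ring e c \<omega>) e)"
    by (simp add: ring_time_set_ring)
qed (intro prob_space_ring prob_space_clocks)+

lemma AE_site:
  assumes "AE x in site_clock r \<tau> z. P x"
  shows "AE \<omega> in clocks r \<tau>. P (\<omega> z)"
proof -
  interpret product_prob_space "site_clock r \<tau>" UNIV
    by (intro product_prob_spaceI prob_space_site_clock)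
  show ?thesis
    unfolding clocks_def using AE_component[OF UNIV_I assms] .
qed

lemma AE_no_rings:
  assumes "\<not> 0 < clock_mass r \<tau> z"
  shows "AE \<omega> in clocks r \<tau>. fst (\<omega> z) = 0"
proof (rule AE_site)
  have "count_dist r \<tau> z = measure_pmf (return_pmf 0)"
    using assms by (simp add: count_dist_def)
  then have "AE n in count_dist r \<tau> z. n = 0"
    by (simp only: AE_measure_pmf_iff) simp
  moreover have "Measurable.pred (count_dist r \<tau> z) (\<lambda>n. n = 0)"
    by (simp add: measurable_cong_sets[OF sets_count_dist refl])
  ultimately show "AE x in site_clock r \<tau> z. fst x = 0"
    unfolding site_clock_def
    by (intro AE_pair_fst prob_space_count_dist prob_space_PiM prob_space_ring)
qed

lemma AE_ring_times_Icc:
  "AE \<omega> in clocks r \<tau>. \<forall>e. snd e < fst (\<omega> (fst e)) \<longrightarrow> ring_time \<omega> e \<in> {0..\<tau>}"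
  unfolding AE_all_countable
proof
  fix e :: "int \<times> nat"
  show "AE \<omega> in clocks r \<tau>. snd e < fst (\<omega> (fst e)) \<longrightarrow> ring_time \<omega> e \<in> {0..\<tau>}"
  proof (cases "0 < clock_mass r \<tau> (fst e)")
    case True
    have "AE \<omega> in clocks r \<tau>. ring_time \<omega> e \<in> {0..\<tau>}"
      by (rule AE_ring_time[OF _ AE_time_dist_Icc[OF True]]) measurable
    then show ?thesis by eventually_elim simp
  next
    case False
    show ?thesis using AE_no_rings[OF False] by eventually_elim simp
  qed
qed

text \<open>An edge of vanishing mass almost surely has no rings, which disposes of the point mass
  in \<open>time_dist\<close>. Otherwise the time of \<open>e\<close> is resampled and held fixed,
  and the time of \<open>e'\<close>, which has a density, almost surely avoids that value.\<close>

lemma AE_ring_times_distinct: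
  "AE \<omega> in clocks r \<tau>. \<forall>e e'. e \<noteq> e' \<and> snd e < fst (\<omega> (fst e)) \<and> snd e' < fst (\<omega> (fst e'))
     \<longrightarrow> ring_time \<omega> e \<noteq> ring_time \<omega> e'"
  unfolding AE_all_countable
proof (intro allI)
  fix e e' :: "int \<times> nat"
  consider "\<not> 0 < clock_mass r \<tau> (fst e)" | "\<not> 0 < clock_mass r \<tau> (fst e')" | "e = e'"
    | "e \<noteq> e'" "0 < clock_mass r \<tau> (fst e')"
    by blast
  then show "AE \<omega> in clocks r \<tau>. e \<noteq> e' \<and> snd e < fst (\<omega> (fst e)) \<and> snd e' < fst (\<omega> (fst e'))
     \<longrightarrow> ring_time \<omega> e \<noteq> ring_time \<omega> e'"
  proof cases
    case 1
    then show ?thesis using AE_no_rings[OF 1] by eventually_elim simp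
  next
    case 2
    then show ?thesis using AE_no_rings[OF 2] by eventually_elim simp
  next
    case 4
    have neq: "AE \<omega> in clocks r \<tau>. ring_time \<omega> e' \<noteq> s" for s
      by (rule AE_ring_time[OF _ AE_time_dist_neq[OF 4(2)]]) measurable
    have "AE \<omega> in clocks r \<tau>. ring_time \<omega> e \<noteq> ring_time \<omega> e'"
    proof (rule AE_resamples[OF resamples_set_ring[of e]])
      show "Measurable.pred (clocks r \<tau>) (\<lambda>\<omega>. ring_time \<omega> e \<noteq> ring_time \<omega> e')"
        unfolding pred_def
        by (intro borel_measurable_neq) (simp_all add: measurable_clocks_eq)
      show "AE c in time_dist r \<tau> (fst e) \<Otimes>\<^sub>M coin_dist. AE \<omega> in clocks r \<tau>.
          ring_time (set_ring e c \<omega>) e \<noteq> ring_time (set_ring e c \<omega>) e'"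
      proof (rule AE_I2)
        fix c
        show "AE \<omega> in clocks r \<tau>. ring_time (set_ring e c \<omega>) e \<noteq> ring_time (set_ring e c \<omega>) e'"
          using neq[of "fst c"] by eventually_elim (use 4(1) in \<open>auto simp: ring_time_set_ring\<close>)
      qed
    qed (intro prob_space_ring prob_space_clocks)+
    then show ?thesis by eventually_elim simp
  qed simp
qed

section \<open>Existence of silent edges\<close>

lemma measure_site_clock_nonzero: "measure (site_clock r \<tau> z) {x. fst x \<noteq> 0} \<le> 1 - exp (- (C * \<tau>))"
proof -
  interpret S: prob_space "site_clock r \<tau> z" by (rule prob_space_site_clock)
  interpret P: prob_space "\<Pi>\<^sub>M i\<in>(UNIV::nat set). time_dist r \<tau> z \<Otimes>\<^sub>M coin_dist"
    by (intro prob_space_PiM prob_space_ring)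
  let ?P = "\<Pi>\<^sub>M i\<in>(UNIV::nat set). time_dist r \<tau> z \<Otimes>\<^sub>M coin_dist"
  have space: "space (site_clock r \<tau> z) = UNIV" "space ?P = UNIV"
    by (simp_all add: site_clock_def space_pair_measure space_PiM
        sets_eq_imp_space_eq[OF sets_count_dist] sets_eq_imp_space_eq[OF sets_time_dist])
  have 0: "{x. fst x = 0} = {0} \<times> space ?P"
    by (auto simp: space)
  have "emeasure (site_clock r \<tau> z) {x. fst x = 0} = emeasure (count_dist r \<tau> z) {0}"
    unfolding 0 site_clock_def
    by (subst P.emeasure_pair_measure_Times) (simp_all add: sets_count_dist P.emeasure_space_1)
  then have "measure (site_clock r \<tau> z) {x. fst x = 0} = exp (- max 0 (clock_mass r \<tau> z))"
    by (simp add: measure_def emeasure_count_dist_0)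
  also have "\<dots> \<ge> exp (- (C * \<tau>))"
    using clock_mass_le[of z] bound_times_time_nonneg by simp
  finally have "exp (- (C * \<tau>)) \<le> measure (site_clock r \<tau> z) {x. fst x = 0}" .
  moreover have "{x. fst x = 0} \<in> sets (site_clock r \<tau> z)"
    unfolding 0 site_clock_def by (intro pair_measureI) (simp_all add: sets_count_dist)
  then have "measure (site_clock r \<tau> z) (space (site_clock r \<tau> z) - {x. fst x = 0})
      = 1 - measure (site_clock r \<tau> z) {x. fst x = 0}"
    by (rule S.prob_compl)
  moreover have "space (site_clock r \<tau> z) - {x. fst x = 0} = {x. fst x \<noteq> 0}"
    by (auto simp: space)
  ultimately show ?thesis by simp
qed

text \<open>Every edge rings with probability at most a common \<open>p < 1\<close>, so by
  independence any \<open>n\<close> edges of \<open>A\<close> all ring with probability at most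
  \<open>p ^ n\<close>, for every \<open>n\<close>.\<close>

lemma AE_quiet_site:
  assumes "infinite A"
  shows "AE \<omega> in clocks r \<tau>. \<exists>a\<in>A. fst (\<omega> a) = 0"
proof -
  interpret P: product_prob_space "site_clock r \<tau>" UNIV
    by (intro product_prob_spaceI prob_space_site_clock)
  define p where "p = 1 - exp (- (C * \<tau>))"
  have p: "0 \<le> p" "p < 1"
    using bound_times_time_nonneg by (simp_all add: p_def)
  let ?bad = "{\<omega> \<in> space (clocks r \<tau>). \<forall>a\<in>A. fst (\<omega> a) \<noteq> 0}"
  have meas: "?bad \<in> sets (clocks r \<tau>)"
    using pred_clocks[of "\<lambda>\<omega>. \<forall>a\<in>A. fst (\<omega> a) \<noteq> 0"] by simp
  have "measure (clocks r \<tau>) ?bad \<le> p ^ n" for n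
  proof -
    obtain J where J: "J \<subseteq> A" "finite J" "card J = n"
      using infinite_arbitrarily_large[OF assms] by metis
    let ?X = "{\<omega> \<in> space (clocks r \<tau>). \<forall>a\<in>J. \<omega> a \<in> {x. fst x \<noteq> 0}}"
    have fst_meas: "{x. fst x \<noteq> 0} \<in> sets (site_clock r \<tau> z)" for z
    proof -
      have [measurable]: "fst \<in> site_clock r \<tau> z \<rightarrow>\<^sub>M count_space UNIV"
        unfolding site_clock_def using sets_count_dist[of r \<tau> z]
        by (metis measurable_fst measurable_cong_sets)
      have "{x \<in> space (site_clock r \<tau> z). fst x \<noteq> 0} \<in> sets (site_clock r \<tau> z)"
        by measurable
      moreover have "space (site_clock r \<tau> z) = UNIV"
        by (simp add: site_clock_def space_pair_measure space_PiM
            sets_eq_imp_space_eq[OF sets_count_dist] sets_eq_imp_space_eq[OF sets_time_dist])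
      ultimately show ?thesis by simp
    qed
    have "?X \<in> sets (clocks r \<tau>)"
      using J(2) pred_clocks[of "\<lambda>\<omega>. \<forall>a\<in>J. \<omega> a \<in> {x. fst x \<noteq> 0}"] by simp
    then have "measure (clocks r \<tau>) ?bad \<le> measure (clocks r \<tau>) ?X"
      using J(1) by (intro clk.finite_measure_mono) auto
    also have "\<dots> = (\<Prod>a\<in>J. measure (site_clock r \<tau> a) {x. fst x \<noteq> 0})"
    proof -
      have "emeasure (clocks r \<tau>) ?X = (\<Prod>a\<in>J. emeasure (site_clock r \<tau> a) {x. fst x \<noteq> 0})"
        using P.emeasure_PiM_Collect[OF subset_UNIV J(2), of "\<lambda>_. {x. fst x \<noteq> 0}"] fst_meas
        by (simp only: clocks_def)
      also have "\<dots> = ennreal (\<Prod>a\<in>J. measure (site_clock r \<tau> a) {x. fst x \<noteq> 0})"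
        by (simp only: P.M.emeasure_eq_measure prod_ennreal measure_nonneg)
      finally show ?thesis
        by (simp only: measure_def) (simp add: prod_nonneg)
    qed
    also have "\<dots> \<le> (\<Prod>a\<in>J. p)"
      unfolding p_def by (intro prod_mono conjI measure_nonneg measure_site_clock_nonzero)
    also have "\<dots> = p ^ n"
      by (simp add: J)
    finally show ?thesis .
  qed
  moreover have "(\<lambda>n. p ^ n) \<longlonglongrightarrow> 0"
    using p by (intro LIMSEQ_realpow_zero) auto
  ultimately have "measure (clocks r \<tau>) ?bad \<le> 0"
    by (intro LIMSEQ_le_const) auto
  then have "measure (clocks r \<tau>) ?bad = 0"
    by (simp add: measure_le_0_iff)
  then show ?thesis
    using meas by (intro AE_I[of _ _ ?bad]) (auto simp: clk.emeasure_eq_measure)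
qed

lemma AE_quiet_edges: "AE \<omega> in clocks r \<tau>. quiet_edges \<omega>"
proof -
  have "infinite {..<0::int}" "infinite {0::int..}"
    by (simp_all add: infinite_Iio infinite_Ici)
  from this[THEN AE_quiet_site] show ?thesis
    by eventually_elim (auto simp: quiet_edges_def)
qed

end

section \<open>Time reversal\<close>

definition transports :: "('a \<Rightarrow> 'b) \<Rightarrow> 'a measure \<Rightarrow> 'b measure \<Rightarrow> bool" where
  "transports f M N \<longleftrightarrow> f \<in> M \<rightarrow>\<^sub>M N \<and> distr M N f = N"

lemma transports_id: "transports (\<lambda>x. x) M M"
  by (simp add: transports_def)

lemma transports_pair:
  assumes f: "transports f M N" and g: "transports g M' N'" and "prob_space N'"
  shows "transports (\<lambda>p. (f (fst p), g (snd p))) (M \<Otimes>\<^sub>M M') (N \<Otimes>\<^sub>M N')"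
proof -
  have [measurable]: "f \<in> M \<rightarrow>\<^sub>M N" "g \<in> M' \<rightarrow>\<^sub>M N'"
    using f g by (simp_all add: transports_def)
  have "distr M N f \<Otimes>\<^sub>M distr M' N' g
      = distr (M \<Otimes>\<^sub>M M') (N \<Otimes>\<^sub>M N') (\<lambda>(x, y). (f x, g y))"
    using g assms(3) by (intro pair_measure_distr) (simp_all add: transports_def prob_space_imp_sigma_finite)
  then show ?thesis
    using f g by (simp add: transports_def case_prod_unfold)
qed

lemma transports_PiM:
  assumes "\<And>i. prob_space (M i)" "\<And>i. transports (f i) (M i) (N i)"
  shows "transports (\<lambda>X i. f i (X i)) (PiM UNIV M) (PiM UNIV N)"
proof -
  have f [measurable]: "f i \<in> M i \<rightarrow>\<^sub>M N i" and eq: "distr (M i) (N i) (f i) = N i" for i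
    using assms(2)[of i] by (simp_all add: transports_def)
  have "(\<lambda>X. \<lambda>i\<in>UNIV. f i (X i)) \<in> PiM UNIV M \<rightarrow>\<^sub>M PiM UNIV N"
    by (intro measurable_restrict) simp
  moreover have "(\<lambda>X. \<lambda>i\<in>UNIV. f i (X i)) = (\<lambda>X i. f i (X i))"
    by (simp add: restrict_def)
  ultimately show ?thesis
    using distr_PiM[of UNIV M f N] by (simp add: transports_def assms(1) eq)
qed

text \<open>Dominated convergence for indicators, with the constant 1 as bound.\<close>

lemma measure_tendsto_eventually_eq:
  assumes "finite_measure M"
    and [measurable]: "\<And>n. Measurable.pred M (Q n)" "Measurable.pred M R"
    and ev: "AE x in M. \<forall>\<^sub>F n in sequentially. Q n x \<longleftrightarrow> R x"
  shows "(\<lambda>n. measure M {x \<in> space M. Q n x}) \<longlonglongrightarrow> measure M {x \<in> space M. R x}"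
proof -
  interpret finite_measure M by fact
  have "(\<lambda>n. \<integral>x. indicator {x \<in> space M. Q n x} x \<partial>M) \<longlonglongrightarrow> (\<integral>x. indicator {x \<in> space M. R x} x \<partial>M :: real)"
  proof (rule integral_dominated_convergence[where w = "\<lambda>_. 1"])
    show "AE x in M. (\<lambda>n. indicator {x \<in> space M. Q n x} x) \<longlonglongrightarrow> (indicator {x \<in> space M. R x} x :: real)"
      using ev
    proof eventually_elim
      case (elim x)
      then have "\<forall>\<^sub>F n in sequentially. indicator {x \<in> space M. Q n x} x = (indicator {x \<in> space M. R x} x :: real)"
        by eventually_elim (simp add: indicator_def)
      then show ?case by (rule tendsto_eventually)
    qed
  qed (auto simp: indicator_def)
  then show ?thesis by simp
qed

text \<open>Distinct times determine the sorted list uniquely. With ties the stable sort would keep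
  the label order in both lists, and they would not be reverses of each other.\<close>

lemma ordered_labels_reverse:
  assumes count: "\<And>z. fst (\<omega>' z) = fst (\<omega> z)"
    and time: "\<And>e. snd e < fst (\<omega> (fst e)) \<Longrightarrow>
      ring_time \<omega> e \<in> {0..\<tau>} \<and> ring_time \<omega>' e = \<tau> - ring_time \<omega> e"
    and dist: "\<And>e e'. e \<noteq> e' \<Longrightarrow> snd e < fst (\<omega> (fst e)) \<Longrightarrow> snd e' < fst (\<omega> (fst e')) \<Longrightarrow>
      ring_time \<omega> e \<noteq> ring_time \<omega> e'"
  shows "ordered_labels \<tau> \<omega>' N = rev (ordered_labels \<tau> \<omega> N)"
proof -
  let ?zs = "[- int N..int N]"
  define b where "b = ring_labels \<omega> ?zs"
  have b: "ring_labels \<omega>' ?zs = b"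
    by (simp add: b_def ring_labels_def count)
  have active: "snd e < fst (\<omega> (fst e))" if "e \<in> set b" for e
    using that by (auto simp: b_def set_ring_labels)
  have 1: "ordered_labels \<tau> \<omega> N = sort_key (ring_time \<omega>) b"
    unfolding ordered_labels_def b_def[symmetric]
    by (subst filter_True) (use active time in auto)
  \<comment> \<open>The cut-off at \<tau> removes nothing here because the original times are
    nonnegative; in \<open>1\<close> it was because they are at most \<tau>.\<close>
  have 2: "ordered_labels \<tau> \<omega>' N = sort_key (ring_time \<omega>') b"
    unfolding ordered_labels_def b
    by (subst filter_True) (use active time in auto)
  have "sort_key (ring_time \<omega>') b = rev (sort_key (ring_time \<omega>) b)"
  proof (rule sort_key_inj_key_eq)
    show "inj_on (ring_time \<omega>') (set b)"
      using active time dist by (intro inj_onI) (metis diff_left_imp_eq)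
    have "sorted_wrt (\<lambda>e e'. ring_time \<omega> e \<le> ring_time \<omega> e') (sort_key (ring_time \<omega>) b)"
      using sorted_sort_key[of "ring_time \<omega>" b] by (simp add: sorted_wrt_map)
    then have "sorted_wrt (\<lambda>e e'. ring_time \<omega>' e' \<le> ring_time \<omega>' e) (sort_key (ring_time \<omega>) b)"
      by (rule sorted_wrt_mono_rel[rotated]) (use active time in auto)
    then show "sorted (map (ring_time \<omega>') (rev (sort_key (ring_time \<omega>) b)))"
      by (simp add: sorted_wrt_map sorted_wrt_rev)
  qed simp
  then show ?thesis by (simp only: 1 2)
qed

section \<open>Reflection of the clocks and the duality\<close>

context asep_rates
begin

abbreviation "rev_rate \<equiv> \<lambda>z u. r z (\<tau> - u)"

lemma indicator_reflect: "indicator {0..\<tau>} (\<tau> - u) = (indicator {0..\<tau>} u :: real)"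
  by (auto simp: indicator_def)

lemma asep_rates_reversed: "asep_rates rev_rate \<tau> C"
proof
  fix z
  have "(\<lambda>u. indicator {0..\<tau>} (\<tau> - u) * r z (\<tau> - u)) \<in> borel_measurable borel"
    by (rule measurable_compose[OF _ rate_measurable]) simp
  then show "(\<lambda>u. indicator {0..\<tau>} u * r z (\<tau> - u)) \<in> borel_measurable borel"
    by (simp only: indicator_reflect)
qed (use time_nonneg rate_bounds in auto)

interpretation reversed: asep_rates rev_rate \<tau> C
  by (rule asep_rates_reversed)

lemma clock_mass_reversed: "clock_mass rev_rate \<tau> z = clock_mass r \<tau> z"
  using lborel_integral_real_affine[of "-1" "\<lambda>u. indicator {0..\<tau>} u * r z u" \<tau>]
  by (simp add: clock_mass_eq reversed.clock_mass_eq indicator_reflect)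

lemma count_dist_reversed: "count_dist rev_rate \<tau> z = count_dist r \<tau> z"
  by (simp add: count_dist_def clock_mass_reversed)

text \<open>For a vanishing clock both time distributions are the same point mass, which must then
  not be reflected.\<close>

definition flip_time :: "int \<Rightarrow> real \<Rightarrow> real" where
  "flip_time z t = (if 0 < clock_mass r \<tau> z then \<tau> - t else t)"

lemma transports_flip_time: "transports (flip_time z) (time_dist r \<tau> z) (time_dist rev_rate \<tau> z)"
proof (cases "0 < clock_mass r \<tau> z")
  case True
  define F where "F u = ennreal (indicator {0..\<tau>} u * r z u / clock_mass r \<tau> z)" for u
  have td: "time_dist r \<tau> z = density lborel F" "time_dist rev_rate \<tau> z = density lborel (\<lambda>u. F (\<tau> - u))"
    using True by (simp_all add: time_dist_def clock_mass_reversed F_def[abs_def] indicator_reflect)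
  have flip: "flip_time z = (\<lambda>t. \<tau> - t)"
    using True by (simp add: flip_time_def fun_eq_iff)
  have [measurable]: "F \<in> borel_measurable borel"
    using rate_measurable[of z] by (simp add: F_def[abs_def])
  have "emeasure (distr (density lborel F) (density lborel (\<lambda>u. F (\<tau> - u))) (\<lambda>t. \<tau> - t)) A
      = emeasure (density lborel (\<lambda>u. F (\<tau> - u))) A" if [measurable]: "A \<in> sets borel" for A
  proof -
    have pre: "(\<lambda>t. \<tau> - t) -` A \<inter> space lborel \<in> sets lborel"
      by (rule measurable_sets[of _ _ borel]) simp_all
    have "emeasure (distr (density lborel F) (density lborel (\<lambda>u. F (\<tau> - u))) (\<lambda>t. \<tau> - t)) A
        = emeasure (density lborel F) ((\<lambda>t. \<tau> - t) -` A \<inter> space lborel)"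
      by (subst emeasure_distr) simp_all
    also have "\<dots> = (\<integral>\<^sup>+u. F u * indicator ((\<lambda>t. \<tau> - t) -` A \<inter> space lborel) u \<partial>lborel)"
      by (rule emeasure_density) (simp_all only: pre, simp)
    also have "\<dots> = (\<integral>\<^sup>+u. F u * indicator A (\<tau> - u) \<partial>lborel)"
      by (rule nn_integral_cong) (simp add: indicator_def)
    also have "\<dots> = (\<integral>\<^sup>+u. F (\<tau> - u) * indicator A u \<partial>lborel)"
      using nn_integral_real_affine[of "\<lambda>u. F u * indicator A (\<tau> - u)" "-1" \<tau>] by simp
    also have "\<dots> = emeasure (density lborel (\<lambda>u. F (\<tau> - u))) A"
      by (subst emeasure_density) simp_all
    finally show ?thesis .
  qed
  then have "distr (density lborel F) (density lborel (\<lambda>u. F (\<tau> - u))) (\<lambda>t. \<tau> - t)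
      = density lborel (\<lambda>u. F (\<tau> - u))"
    by (intro measure_eqI) simp_all
  then show ?thesis
    by (simp add: transports_def td flip)
next
  case False
  then have "time_dist r \<tau> z = time_dist rev_rate \<tau> z" "flip_time z = (\<lambda>t. t)"
    by (simp_all add: time_dist_def clock_mass_reversed flip_time_def fun_eq_iff)
  then show ?thesis
    by (simp add: transports_id)
qed

text \<open>Counts, coins and label indices are kept, so reflection permutes the order in which the
  same labels are visited.\<close>

definition flip_rings :: "rings \<Rightarrow> rings" where
  "flip_rings \<omega> = (\<lambda>z. (fst (\<omega> z), \<lambda>i. (flip_time z (fst (snd (\<omega> z) i)), snd (snd (\<omega> z) i))))"

lemma transports_flip_rings: "transports flip_rings (clocks r \<tau>) (clocks rev_rate \<tau>)"
proof -
  let ?f = "\<lambda>z p. (flip_time z (fst p), snd p :: real)"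
  have "transports (\<lambda>X i. ?f z (X i)) (\<Pi>\<^sub>M i\<in>(UNIV::nat set). time_dist r \<tau> z \<Otimes>\<^sub>M coin_dist)
      (\<Pi>\<^sub>M i\<in>UNIV. time_dist rev_rate \<tau> z \<Otimes>\<^sub>M coin_dist)" for z
    by (intro transports_PiM[where f = "\<lambda>_. ?f z"] prob_space_ring
        transports_pair[where g = "\<lambda>x. x"] transports_flip_time transports_id prob_space_coin_dist)
  then have "transports (\<lambda>s. (fst s, \<lambda>i. ?f z (snd s i))) (site_clock r \<tau> z) (site_clock rev_rate \<tau> z)" for z
    unfolding site_clock_def count_dist_reversed
    by (intro transports_pair[where f = "\<lambda>x. x" and g = "\<lambda>X i. ?f z (X i)"] transports_id
        prob_space_PiM reversed.prob_space_ring)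
  then show ?thesis
    unfolding clocks_def flip_rings_def
    by (intro transports_PiM[where f = "\<lambda>z s. (fst s, \<lambda>i. ?f z (snd s i))"] prob_space_site_clock)
qed

text \<open>Almost surely an edge that rings has positive mass, so \<open>flip_time\<close> really
  reflects every time that matters.\<close>

lemma AE_ordered_labels_flip:
  "AE \<omega> in clocks r \<tau>. ordered_labels \<tau> (flip_rings \<omega>) N = rev (ordered_labels \<tau> \<omega> N)"
proof -
  have "AE \<omega> in clocks r \<tau>. \<forall>z. \<not> 0 < clock_mass r \<tau> z \<longrightarrow> fst (\<omega> z) = 0"
    unfolding AE_all_countable
  proof
    fix z
    show "AE \<omega> in clocks r \<tau>. \<not> 0 < clock_mass r \<tau> z \<longrightarrow> fst (\<omega> z) = 0"
      using AE_no_rings[of z] by (cases "0 < clock_mass r \<tau> z") simp_all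
  qed
  with AE_ring_times_Icc AE_ring_times_distinct show ?thesis
  proof eventually_elim
    case (elim \<omega>)
    show ?case
    proof (rule ordered_labels_reverse)
      fix e :: "int \<times> nat" assume e: "snd e < fst (\<omega> (fst e))"
      then have "0 < clock_mass r \<tau> (fst e)"
        using elim(3) by force
      then show "ring_time \<omega> e \<in> {0..\<tau>} \<and> ring_time (flip_rings \<omega>) e = \<tau> - ring_time \<omega> e"
        using elim(1) e by (auto simp: ring_time_def flip_rings_def flip_time_def)
    next
      fix e e' :: "int \<times> nat"
      assume "e \<noteq> e'" "snd e < fst (\<omega> (fst e))" "snd e' < fst (\<omega> (fst e'))"
      then show "ring_time \<omega> e \<noteq> ring_time \<omega> e'"
        using elim(2) by blast
    qed (simp add: flip_rings_def)
  qed
qed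

lemma window_duality:
  assumes q: "0 \<le> q" "q \<le> 1"
  shows "measure (clocks r \<tau>) {\<omega> \<in> space (clocks r \<tau>). real_of_int (inv (perm_config q \<tau> \<omega> N) 0) \<le> x}
    = measure (clocks rev_rate \<tau>)
        {\<omega> \<in> space (clocks rev_rate \<tau>). real_of_int (perm_config q \<tau> \<omega> N 0) \<le> x}"
proof -
  let ?F = "\<lambda>w :: int \<Rightarrow> int. of_bool (real_of_int (inv w 0) \<le> x) :: real"
  let ?G = "\<lambda>w :: int \<Rightarrow> int. of_bool (real_of_int (w 0) \<le> x) :: real"
  let ?l = "\<lambda>\<omega>. ordered_labels \<tau> \<omega> N"
  let ?E = "\<lambda>F L. ennreal (foldr (swap_op q) (map fst L) F id)"
  have rev: "?E ?F L = ?E ?G (rev L)" for L :: "(int \<times> nat) list"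
  proof -
    have "foldr (swap_op q) (map fst L) ?F id = foldr (swap_op q) (rev (map fst L)) (\<lambda>w. ?F (inv w)) id"
      by (rule foldr_swap_op_rev)
    \<comment> \<open>The double inverse cancels on bijections, the only configurations reachable
      from \<open>id\<close>.\<close>
    also have "\<dots> = foldr (swap_op q) (rev (map fst L)) ?G id"
      by (rule foldr_swap_op_cong) (simp_all add: inv_inv_eq)
    finally show ?thesis by (simp only: rev_map)
  qed
  have flip: "flip_rings \<in> clocks r \<tau> \<rightarrow>\<^sub>M clocks rev_rate \<tau>"
    and distr: "distr (clocks r \<tau>) (clocks rev_rate \<tau>) flip_rings = clocks rev_rate \<tau>"
    using transports_flip_rings by (simp_all add: transports_def)
  have meas: "(\<lambda>\<omega>. ?E ?G (?l \<omega>)) \<in> borel_measurable (clocks rev_rate \<tau>)"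
    unfolding measurable_clocks_eq by (rule measurable_compose[OF measurable_ordered_labels]) simp
  have "emeasure (clocks r \<tau>) {\<omega> \<in> space (clocks r \<tau>). real_of_int (inv (perm_config q \<tau> \<omega> N) 0) \<le> x}
      = (\<integral>\<^sup>+\<omega>. ?E ?F (?l \<omega>) \<partial>clocks r \<tau>)"
    by (rule emeasure_perm_config[OF q])
  \<comment> \<open>The reversed word is the word of the reflected clocks, whose law is that of the
    clocks with reversed rates.\<close>
  also have "\<dots> = (\<integral>\<^sup>+\<omega>. ?E ?G (?l (flip_rings \<omega>)) \<partial>clocks r \<tau>)"
    by (rule nn_integral_cong_AE, use AE_ordered_labels_flip[of N] in eventually_elim) (simp only: rev)
  also have "\<dots> = (\<integral>\<^sup>+\<omega>. ?E ?G (?l \<omega>) \<partial>clocks rev_rate \<tau>)"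
    using nn_integral_distr[OF flip, of "\<lambda>\<omega>. ?E ?G (?l \<omega>)"] meas by (simp only: distr)
  also have "\<dots> = emeasure (clocks rev_rate \<tau>)
      {\<omega> \<in> space (clocks rev_rate \<tau>). real_of_int (perm_config q \<tau> \<omega> N 0) \<le> x}"
    by (rule reversed.emeasure_perm_config[OF q, symmetric])
  finally show ?thesis by (simp only: measure_def)
qed

text \<open>By \<open>window_duality\<close> one sequence of finite-window probabilities converges
  to both sides, since almost surely each event is decided by all large windows.\<close>

lemma duality:
  assumes q: "0 \<le> q" "q \<le> 1"
  shows "measure (clocks r \<tau>) {\<omega> \<in> space (clocks r \<tau>). real_of_int (f2 q \<tau> \<omega>) \<le> x}
    = measure (clocks rev_rate \<tau>)
        {\<omega> \<in> space (clocks rev_rate \<tau>). asep_config q \<tau> (eta0_step x) \<omega> 0 = 1}"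
proof (rule LIMSEQ_unique)
  show "(\<lambda>N. measure (clocks r \<tau>)
        {\<omega> \<in> space (clocks r \<tau>). real_of_int (inv (perm_config q \<tau> \<omega> N) 0) \<le> x})
      \<longlonglongrightarrow> measure (clocks r \<tau>) {\<omega> \<in> space (clocks r \<tau>). real_of_int (f2 q \<tau> \<omega>) \<le> x}"
  proof (rule measure_tendsto_eventually_eq)
    show "AE \<omega> in clocks r \<tau>. \<forall>\<^sub>F N in sequentially.
        real_of_int (inv (perm_config q \<tau> \<omega> N) 0) \<le> x \<longleftrightarrow> real_of_int (f2 q \<tau> \<omega>) \<le> x"
      using AE_quiet_edges by eventually_elim (rule f2_le_iff_eventually)
  qed (simp_all add: measurable_clocks_eq prob_space.finite_measure prob_space_clocks)
  show "(\<lambda>N. measure (clocks r \<tau>)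
        {\<omega> \<in> space (clocks r \<tau>). real_of_int (inv (perm_config q \<tau> \<omega> N) 0) \<le> x})
      \<longlonglongrightarrow> measure (clocks rev_rate \<tau>)
        {\<omega> \<in> space (clocks rev_rate \<tau>). asep_config q \<tau> (eta0_step x) \<omega> 0 = 1}"
    unfolding window_duality[OF q]
  proof (rule measure_tendsto_eventually_eq)
    show "AE \<omega> in clocks rev_rate \<tau>. \<forall>\<^sub>F N in sequentially.
        real_of_int (perm_config q \<tau> \<omega> N 0) \<le> x \<longleftrightarrow> asep_config q \<tau> (eta0_step x) \<omega> 0 = 1"
      using reversed.AE_quiet_edges by eventually_elim (rule asep_step_eq_one_iff_eventually)
  qed (simp_all add: measurable_clocks_eq prob_space.finite_measure reversed.prob_space_clocks)
qed

end

text \<open>Off the finite exceptional set the function is continuous on a Borel set; on that set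
  its values are arbitrary.\<close>

lemma piecewise_continuous_measurable:
  assumes "piecewise_continuous f" "0 \<le> T"
  shows "(\<lambda>u. indicator {0..T} u * f u) \<in> borel_measurable borel"
proof -
  obtain S where S: "finite S" "\<And>u. u \<in> {0..T} - S \<Longrightarrow> continuous (at u within {0..}) f"
    using assms unfolding piecewise_continuous_def by meson
  have cont: "continuous_on ({0..T} - S) f"
    unfolding continuous_on_eq_continuous_within
    by (intro ballI continuous_within_subset[OF S(2)]) auto
  have sets: "{0..T} - S \<in> sets borel"
    using borel_closed[OF finite_imp_closed[OF S(1)]] by simp
  have "(\<lambda>u. indicator ({0..T} - S) u *\<^sub>R f u) \<in> borel_measurable borel"
    using borel_measurable_continuous_on_indicator[OF sets cont] .
  \<comment> \<open>Restores the values at the exceptional points, one point indicator each.\<close>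
  moreover have "(\<lambda>u. \<Sum>s\<in>S \<inter> {0..T}. f s * indicator {s} u) \<in> borel_measurable borel"
    by simp
  ultimately have "(\<lambda>u. indicator ({0..T} - S) u *\<^sub>R f u + (\<Sum>s\<in>S \<inter> {0..T}. f s * indicator {s} u))
      \<in> borel_measurable borel"
    by (rule borel_measurable_add)
  also have "(\<lambda>u. indicator ({0..T} - S) u *\<^sub>R f u + (\<Sum>s\<in>S \<inter> {0..T}. f s * indicator {s} u))
      = (\<lambda>u. indicator {0..T} u * f u)"
    using S(1) by (auto simp: fun_eq_iff indicator_def sum.delta' if_distrib[of "(*) _"] cong: if_cong)
  finally show ?thesis .
qed

theorem theorem4p1:
  fixes q C \<tau> x :: real and r :: "int \<Rightarrow> real \<Rightarrow> real"
  assumes "0 \<le> q" "q \<le> 1"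
    and "\<And>z u. 0 \<le> u \<Longrightarrow> 0 \<le> r z u \<and> r z u \<le> C"
    and "\<And>z. piecewise_continuous (r z)"
    and "0 \<le> \<tau>"
  shows "measure (clocks r \<tau>) {\<omega> \<in> space (clocks r \<tau>). real_of_int (f2 q \<tau> \<omega>) \<le> x}
       = measure (clocks (\<lambda>z u. r z (\<tau> - u)) \<tau>)
           {\<omega> \<in> space (clocks (\<lambda>z u. r z (\<tau> - u)) \<tau>).
              asep_config q \<tau> (eta0_step x) \<omega> 0 = 1}"
proof -
  interpret asep_rates r \<tau> C
    using assms by unfold_locales (auto intro: piecewise_continuous_measurable)
  show ?thesis
    using assms(1,2) by (rule duality)
qed

end
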